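(* Let $k$ be a field, $R = k[x_1,\dots,x_d]$, and $\mathfrak m = (x_1,\dots,x_d)$. Let $I \subseteq R$ be a square-free monomial ideal such that every proper minor of $I$ is normally torsion-free. Suppose that $I$ does not have the packing property. Then $\mathfrak m \in \operatorname{Ass}(R/I^{\beta_1(I)+1})$, and $\beta_1(I)+1$ is the least power $t$ such that $\mathfrak m \in \operatorname{Ass}(R/I^t)$.
   Context: Normally torsion-free: an ideal $I$ of a Noetherian ring $R$ is normally torsion-free if $\operatorname{Ass}(R/I^t) = \operatorname{Ass}(R/I)$ for all $t \ge 1$. Minors: let $I \subseteq k[x_1,\dots,x_d]$ be a square-free monomial ideal and $x$ one of the variables. The deletion of $x$ is the ideal, in the polynomial ring on the remaining variables, generated by the images of the generators of $I$ after setting $x=0$ (i.e. by the minimal monomial generators of $I$ not divisible by $x$). The contraction of $x$ is the ideal, in the polynomial ring on the remaining variables, generated by the images of the generators of $I$ after setting $x=1$. A minor of $I$ is an ideal obtained from $I$ by a sequence of deletions and contractions; it is proper if at least one deletion or contraction is performed. $\alpha_0(I)$ is the height of $I$ (equivalently, the minimum cardinality of a set of variables meeting the support of every minimal generator of $I$). $\beta_1(I)$ is the maximum cardinality of a set of minimal monomial generators of $I$ with pairwise disjoint supports. $I$ satisfies the König property if $\alpha_0(I)=\beta_1(I)$. $I$ has the packing property if $I$ and all of its minors satisfy the König property. (Convention: the zero ideal has $\alpha_0=\beta_1=0$, and a minor equal to the unit ideal is regarded as satisfying the König property. The edges of a hypergraph are nonempty, so $I$ itself is a proper ideal.) *)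

theory Defs
  imports
    "HOL-Library.Poly_Mapping"
    "HOL-Library.Extended_Nat"
    "HOL-Algebra.Ideal_Product"
begin

section \<open>Associated primes, normal torsion-freeness, height\<close>

definition ideal_pow :: "('a, 'b) ring_scheme \<Rightarrow> 'a set \<Rightarrow> nat \<Rightarrow> 'a set" where
  "ideal_pow R I t = I [^]\<^bsub>ideals_set R\<^esub> t"

text \<open>The set of primes \<open>Ass(R/I)\<close>: the prime ideals which are the annihilator of some element
  \<open>f + I\<close> of the \<open>R\<close>-module \<open>R/I\<close>.  The annihilator of \<open>f + I\<close> is the colon ideal \<open>(I : f)\<close>.\<close>

definition Ass :: "('a, 'b) ring_scheme \<Rightarrow> 'a set \<Rightarrow> 'a set set" where
  "Ass R I = {P. primeideal P R \<and>
                 (\<exists>f\<in>carrier R. P = {r \<in> carrier R. r \<otimes>\<^bsub>R\<^esub> f \<in> I})}"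

definition normally_torsion_free :: "('a, 'b) ring_scheme \<Rightarrow> 'a set \<Rightarrow> bool" where
  "normally_torsion_free R I \<longleftrightarrow> (\<forall>t\<ge>1. Ass R (ideal_pow R I t) = Ass R I)"

definition prime_height :: "('a, 'b) ring_scheme \<Rightarrow> 'a set \<Rightarrow> enat" where
  "prime_height R P = Sup {enat n | n. \<exists>C :: nat \<Rightarrow> 'a set.
     (\<forall>i\<le>n. primeideal (C i) R) \<and> (\<forall>i<n. C i \<subset> C (Suc i)) \<and> C n = P}"

definition ideal_height :: "('a, 'b) ring_scheme \<Rightarrow> 'a set \<Rightarrow> enat" where
  "ideal_height R I = Inf {prime_height R P | P. primeideal P R \<and> I \<subseteq> P}"


section \<open>Polynomial rings and square-free monomial ideals\<close>

text \<open>A monomial is given by its exponent vector, of type \<open>'v \<Rightarrow>\<^sub>0 nat\<close>, whose set of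
  \<^const>\<open>Poly_Mapping.keys\<close> is its support.  Deletions and contractions change the set of
  variables, so the polynomial ring over \<open>'k\<close> in the variables \<open>X\<close> is the subring, with explicit
  carrier, of the polynomials in which only variables from \<open>X\<close> occur.\<close>

definition mpoly_ring :: "'v set \<Rightarrow> (('v \<Rightarrow>\<^sub>0 nat) \<Rightarrow>\<^sub>0 'k::field) ring" where
  "mpoly_ring X = \<lparr>carrier = {p. \<forall>e \<in> Poly_Mapping.keys p. Poly_Mapping.keys e \<subseteq> X},
     mult = (*), one = 1, zero = 0, add = (+)\<rparr>"

lemma cring_mpoly_ring: "cring (mpoly_ring X :: (('v \<Rightarrow>\<^sub>0 nat) \<Rightarrow>\<^sub>0 'k::field) ring)"
proof (rule cringI)
  show "abelian_group (mpoly_ring X :: (('v \<Rightarrow>\<^sub>0 nat) \<Rightarrow>\<^sub>0 'k::field) ring)"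
  proof (rule abelian_groupI)
    fix p q :: "('v \<Rightarrow>\<^sub>0 nat) \<Rightarrow>\<^sub>0 'k"
    assume "p \<in> carrier (mpoly_ring X)" "q \<in> carrier (mpoly_ring X)"
    then show "p \<oplus>\<^bsub>mpoly_ring X\<^esub> q \<in> carrier (mpoly_ring X)"
      using Poly_Mapping.keys_add[of p q] by (fastforce simp: mpoly_ring_def)
  next
    fix p :: "('v \<Rightarrow>\<^sub>0 nat) \<Rightarrow>\<^sub>0 'k"
    assume "p \<in> carrier (mpoly_ring X)"
    then show "\<exists>q\<in>carrier (mpoly_ring X). q \<oplus>\<^bsub>mpoly_ring X\<^esub> p = \<zero>\<^bsub>mpoly_ring X\<^esub>"
      by (intro bexI[of _ "- p"]) (auto simp: mpoly_ring_def)
  qed (auto simp: mpoly_ring_def algebra_simps)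
  show "Group.comm_monoid (mpoly_ring X :: (('v \<Rightarrow>\<^sub>0 nat) \<Rightarrow>\<^sub>0 'k::field) ring)"
  proof (rule comm_monoidI)
    fix p q :: "('v \<Rightarrow>\<^sub>0 nat) \<Rightarrow>\<^sub>0 'k"
    assume *: "p \<in> carrier (mpoly_ring X)" "q \<in> carrier (mpoly_ring X)"
    have "Poly_Mapping.keys e \<subseteq> X" if e: "e \<in> Poly_Mapping.keys (p * q)" for e
    proof -
      obtain a b where "e = a + b" "a \<in> Poly_Mapping.keys p" "b \<in> Poly_Mapping.keys q"
        using e Poly_Mapping.keys_mult[of p q] by blast
      then show ?thesis
        using * Poly_Mapping.keys_add[of a b] by (fastforce simp: mpoly_ring_def)
    qed
    then show "p \<otimes>\<^bsub>mpoly_ring X\<^esub> q \<in> carrier (mpoly_ring X)"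
      by (simp add: mpoly_ring_def)
  qed (auto simp: mpoly_ring_def algebra_simps)
qed (auto simp: mpoly_ring_def algebra_simps)

definition mvmon :: "('v \<Rightarrow>\<^sub>0 nat) \<Rightarrow> (('v \<Rightarrow>\<^sub>0 nat) \<Rightarrow>\<^sub>0 'k::field)" where
  "mvmon e = Poly_Mapping.single e 1"

definition var :: "'v \<Rightarrow> (('v \<Rightarrow>\<^sub>0 nat) \<Rightarrow>\<^sub>0 'k::field)" where
  "var x = mvmon (Poly_Mapping.single x 1)"

definition squarefree_monomial_ideal ::
    "'v set \<Rightarrow> (('v \<Rightarrow>\<^sub>0 nat) \<Rightarrow>\<^sub>0 'k::field) set \<Rightarrow> bool" where
  "squarefree_monomial_ideal X I \<longleftrightarrow>
     (\<exists>E. (\<forall>e\<in>E. Poly_Mapping.keys e \<subseteq> X \<and> (\<forall>v. Poly_Mapping.lookup e v \<le> 1)) \<and>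
          I = genideal (mpoly_ring X) (mvmon ` E))"

text \<open>Exponent vectors of the minimal monomial generators of a monomial ideal: the monomials of
  the ideal that are minimal with respect to divisibility.\<close>

definition min_gens :: "(('v \<Rightarrow>\<^sub>0 nat) \<Rightarrow>\<^sub>0 'k::field) set \<Rightarrow> ('v \<Rightarrow>\<^sub>0 nat) set" where
  "min_gens I = {e. mvmon e \<in> I \<and>
     (\<forall>e'. mvmon e' \<in> I \<and> (\<forall>v. Poly_Mapping.lookup e' v \<le> Poly_Mapping.lookup e v) \<longrightarrow> e' = e)}"


section \<open>Minors\<close>

text \<open>The value of a polynomial under the substitution \<open>x = c\<close>.\<close>

definition set_var ::
    "'v \<Rightarrow> 'k \<Rightarrow> (('v \<Rightarrow>\<^sub>0 nat) \<Rightarrow>\<^sub>0 'k::field) \<Rightarrow> (('v \<Rightarrow>\<^sub>0 nat) \<Rightarrow>\<^sub>0 'k)" where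
  "set_var x c p = (\<Sum>e\<in>Poly_Mapping.keys p.
     Poly_Mapping.single (Poly_Mapping.update x 0 e)
       (Poly_Mapping.lookup p e * c ^ Poly_Mapping.lookup e x))"

definition deletion ::
    "'v set \<Rightarrow> 'v \<Rightarrow> (('v \<Rightarrow>\<^sub>0 nat) \<Rightarrow>\<^sub>0 'k::field) set \<Rightarrow> (('v \<Rightarrow>\<^sub>0 nat) \<Rightarrow>\<^sub>0 'k) set" where
  "deletion X x I = genideal (mpoly_ring (X - {x})) (set_var x 0 ` mvmon ` min_gens I)"

definition contraction ::
    "'v set \<Rightarrow> 'v \<Rightarrow> (('v \<Rightarrow>\<^sub>0 nat) \<Rightarrow>\<^sub>0 'k::field) set \<Rightarrow> (('v \<Rightarrow>\<^sub>0 nat) \<Rightarrow>\<^sub>0 'k) set" where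
  "contraction X x I = genideal (mpoly_ring (X - {x})) (set_var x 1 ` mvmon ` min_gens I)"

text \<open>An ideal \<open>I\<close> of the polynomial ring in the variables \<open>X\<close> is represented by the pair
  \<open>(X, I)\<close>, so that a minor comes with the polynomial ring it lives in.\<close>

definition minor_step ::
    "'v set \<times> (('v \<Rightarrow>\<^sub>0 nat) \<Rightarrow>\<^sub>0 'k::field) set \<Rightarrow> 'v set \<times> (('v \<Rightarrow>\<^sub>0 nat) \<Rightarrow>\<^sub>0 'k) set \<Rightarrow> bool" where
  "minor_step XI YJ \<longleftrightarrow> (case XI of (X, I) \<Rightarrow> \<exists>x\<in>X.
     YJ = (X - {x}, deletion X x I) \<or> YJ = (X - {x}, contraction X x I))"

definition minor ::
    "'v set \<times> (('v \<Rightarrow>\<^sub>0 nat) \<Rightarrow>\<^sub>0 'k::field) set \<Rightarrow> 'v set \<times> (('v \<Rightarrow>\<^sub>0 nat) \<Rightarrow>\<^sub>0 'k) set \<Rightarrow> bool" where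
  "minor = minor_step\<^sup>*\<^sup>*"

definition proper_minor ::
    "'v set \<times> (('v \<Rightarrow>\<^sub>0 nat) \<Rightarrow>\<^sub>0 'k::field) set \<Rightarrow> 'v set \<times> (('v \<Rightarrow>\<^sub>0 nat) \<Rightarrow>\<^sub>0 'k) set \<Rightarrow> bool" where
  "proper_minor = minor_step\<^sup>+\<^sup>+"


section \<open>The packing property\<close>

definition alpha0 :: "'v set \<Rightarrow> (('v \<Rightarrow>\<^sub>0 nat) \<Rightarrow>\<^sub>0 'k::field) set \<Rightarrow> enat" where
  "alpha0 X I = ideal_height (mpoly_ring X) I"

text \<open>For a square-free monomial ideal in finitely many variables the set of minimal generators is
  finite, so the maximum below is taken over a finite nonempty set.\<close>

definition beta1 :: "(('v \<Rightarrow>\<^sub>0 nat) \<Rightarrow>\<^sub>0 'k::field) set \<Rightarrow> nat" where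
  "beta1 I = Max {card S | S. S \<subseteq> min_gens I \<and>
     pairwise (\<lambda>e e'. Poly_Mapping.keys e \<inter> Poly_Mapping.keys e' = {}) S}"

text \<open>The first disjunct is the convention for minors equal to the unit ideal.\<close>

definition koenig :: "'v set \<Rightarrow> (('v \<Rightarrow>\<^sub>0 nat) \<Rightarrow>\<^sub>0 'k::field) set \<Rightarrow> bool" where
  "koenig X I \<longleftrightarrow> I = carrier (mpoly_ring X) \<or> alpha0 X I = enat (beta1 I)"

definition packing_property :: "'v set \<Rightarrow> (('v \<Rightarrow>\<^sub>0 nat) \<Rightarrow>\<^sub>0 'k::field) set \<Rightarrow> bool" where
  "packing_property X I \<longleftrightarrow> (\<forall>Y J. minor (X, I) (Y, J) \<longrightarrow> koenig Y J)"

end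

theory Submission
  imports Defs
begin

text \<open>Let \<open>F\<close> be the hypergraph of generators of \<open>I\<close>. The monomial \<open>x\<^sub>1\<dots>x\<^sub>d\<close> lies in \<open>I\<^sup>t\<close> iff
  \<open>F\<close> has \<open>t\<close> disjoint edges, and in the \<open>t\<close>-th symbolic power iff every vertex cover has at least
  \<open>t\<close> elements. For normally torsion-free ideals the two powers agree, so such ideals are Koenig;
  hence the failure of packing happens at \<open>I\<close> itself and every cover has more than \<open>\<beta>\<^sub>1(I)\<close> elements.
  For \<open>t = \<beta>\<^sub>1(I) + 1\<close> the monomial \<open>x\<^sub>1\<dots>x\<^sub>d\<close> is therefore not in \<open>I\<^sup>t\<close>, while normal
  torsion-freeness of the contraction of \<open>x\<^sub>i\<close> puts \<open>x\<^sub>i\<^sup>t x\<^sub>1\<dots>x\<^sub>d\<close> into \<open>I\<^sup>t\<close> for each \<open>i\<close>, so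
  some multiple of it has annihilator \<open>m\<close> modulo \<open>I\<^sup>t\<close>.
  Conversely let \<open>x\<^sup>a\<close> have annihilator \<open>m\<close> modulo \<open>I\<^sup>t\<close>. If all \<open>a\<^sub>i\<close> are positive, then \<open>x\<^sup>a\<close> is
  divisible by a product of \<open>\<beta>\<^sub>1(I)\<close> disjoint generators, so \<open>t > \<beta>\<^sub>1(I)\<close>. If \<open>a\<^sub>i = 0\<close>, then the
  maximal ideal is associated to a power of the deletion of \<open>x\<^sub>i\<close>, hence to the deletion, which then
  contains all its variables; but in that case \<open>I\<close> is Koenig.\<close>

section \<open>Monomial ideals\<close>

type_synonym ('v, 'k) mpoly = "('v \<Rightarrow>\<^sub>0 nat) \<Rightarrow>\<^sub>0 'k"

lemma carrier_mpoly_ring: "carrier (mpoly_ring X) = {p. \<forall>e\<in>Poly_Mapping.keys p. Poly_Mapping.keys e \<subseteq> X}"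
  and mult_mpoly_ring [simp]: "p \<otimes>\<^bsub>mpoly_ring X\<^esub> q = p * q"
  and one_mpoly_ring [simp]: "\<one>\<^bsub>mpoly_ring X\<^esub> = 1"
  and zero_mpoly_ring [simp]: "\<zero>\<^bsub>mpoly_ring X\<^esub> = 0"
  and add_mpoly_ring [simp]: "p \<oplus>\<^bsub>mpoly_ring X\<^esub> q = p + q"
  by (simp_all add: mpoly_ring_def)

lemma ring_mpoly_ring: "ring (mpoly_ring X)"
  using cring_mpoly_ring by (rule cring.axioms(1))

lemma single_in_carrier_mpoly_ring:
  "Poly_Mapping.keys e \<subseteq> X \<Longrightarrow> Poly_Mapping.single e c \<in> carrier (mpoly_ring X)"
  by (simp add: carrier_mpoly_ring)

lemma mpoly_ring_a_inv:
  fixes p :: "('v, 'k::field) mpoly"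
  assumes "p \<in> carrier (mpoly_ring X)"
  shows "\<ominus>\<^bsub>mpoly_ring X\<^esub> p = - p"
proof -
  interpret cring "mpoly_ring X :: ('v, 'k) mpoly ring" by (rule cring_mpoly_ring)
  show ?thesis
    using assms by (intro minus_equality) (auto simp: carrier_mpoly_ring)
qed

text \<open>Additive inverses come from multiplication by the constant \<open>- 1\<close>, which
  lies in the carrier.\<close>

lemma ideal_mpoly_ringI:
  fixes I :: "('v, 'k::field) mpoly set"
  assumes sub: "I \<subseteq> carrier (mpoly_ring X)" and z: "0 \<in> I"
    and add: "\<And>p q. p \<in> I \<Longrightarrow> q \<in> I \<Longrightarrow> p + q \<in> I"
    and mult: "\<And>r p. r \<in> carrier (mpoly_ring X) \<Longrightarrow> p \<in> I \<Longrightarrow> r * p \<in> I"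
  shows "ideal I (mpoly_ring X)"
proof (intro idealI)
  show "ring (mpoly_ring X :: ('v, 'k) mpoly ring)" by (rule ring_mpoly_ring)
  have m1: "- 1 \<in> carrier (mpoly_ring X :: ('v, 'k) mpoly ring)"
    by (simp add: carrier_mpoly_ring)
  show "subgroup I (add_monoid (mpoly_ring X))"
  proof (unfold subgroup_def, intro conjI allI impI)
    fix p assume p: "p \<in> I"
    have "- 1 * p \<in> I" using mult[OF m1 p] .
    then show "inv\<^bsub>add_monoid (mpoly_ring X)\<^esub> p \<in> I"
      using mpoly_ring_a_inv[of p X] p sub by (auto simp: a_inv_def)
  qed (use sub z add in auto)
next
  fix p r :: "('v, 'k) mpoly"
  assume "p \<in> I" "r \<in> carrier (mpoly_ring X)"
  then show "r \<otimes>\<^bsub>mpoly_ring X\<^esub> p \<in> I" "p \<otimes>\<^bsub>mpoly_ring X\<^esub> r \<in> I"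
    using mult[of r p] by (simp_all add: mult.commute)
qed

context
  fixes I :: "('v, 'k::field) mpoly set" and X
  assumes I: "ideal I (mpoly_ring X)"
begin

interpretation ideal I "mpoly_ring X" by (rule I)

lemma ideal_mpoly_ring_zero: "0 \<in> I"
  using additive_subgroup.zero_closed[OF is_additive_subgroup] by simp

lemma ideal_mpoly_ring_add: "p \<in> I \<Longrightarrow> q \<in> I \<Longrightarrow> p + q \<in> I"
  using additive_subgroup.a_closed[OF is_additive_subgroup] by simp

lemma ideal_mpoly_ring_mult: "p \<in> I \<Longrightarrow> r \<in> carrier (mpoly_ring X) \<Longrightarrow> r * p \<in> I"
  using I_l_closed by simp

lemma ideal_mpoly_ring_sub: "I \<subseteq> carrier (mpoly_ring X)"
  using a_subset by simp

lemma ideal_mpoly_ring_diff: "p \<in> I \<Longrightarrow> q \<in> I \<Longrightarrow> p - q \<in> I"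
  using ideal_mpoly_ring_add[of p "-1 * q"] ideal_mpoly_ring_mult[of q "- 1"]
  by (simp add: carrier_mpoly_ring)

end

section \<open>Subspaces and ideals spanned by monomials\<close>

lemma poly_mapping_sum_single:
  "p = (\<Sum>e\<in>Poly_Mapping.keys p. Poly_Mapping.single e (Poly_Mapping.lookup p e))"
  by (rule poly_mapping_eqI)
    (auto simp: lookup_sum lookup_single when_def in_keys_iff)

text \<open>The predicate on exponents makes membership a term-by-term test. The set is an ideal
  once \<open>Q\<close> is stable under multiplication; other choices of \<open>Q\<close> give plain
  subspaces, such as polynomials with bounded exponents.\<close>

definition mono_ideal ::
    "'v set \<Rightarrow> (('v \<Rightarrow>\<^sub>0 nat) \<Rightarrow> bool) \<Rightarrow> ('v, 'k::field) mpoly set" where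
  "mono_ideal X Q = {p. \<forall>e\<in>Poly_Mapping.keys p. Poly_Mapping.keys e \<subseteq> X \<and> Q e}"

lemma keys_add_nat:
  fixes a b :: "'v \<Rightarrow>\<^sub>0 nat"
  shows "Poly_Mapping.keys (a + b) = Poly_Mapping.keys a \<union> Poly_Mapping.keys b"
  by (auto simp: in_keys_iff lookup_add)

text \<open>Every exponent of a product is a sum of exponents of the factors. Three separate
  predicates let the lemma serve for absorption, for products of ideals and for adding exponent
  bounds.\<close>

lemma mono_ideal_mult:
  assumes Q: "\<And>e f. Q e \<Longrightarrow> Q' f \<Longrightarrow> Poly_Mapping.keys e \<subseteq> X \<Longrightarrow> Poly_Mapping.keys f \<subseteq> X \<Longrightarrow> Q'' (e + f)"
    and "p \<in> mono_ideal X Q" "q \<in> mono_ideal X Q'"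
  shows "p * q \<in> mono_ideal X Q''"
  unfolding mono_ideal_def
proof (intro CollectI ballI)
  fix e assume "e \<in> Poly_Mapping.keys (p * q)"
  then obtain a b where "e = a + b" "a \<in> Poly_Mapping.keys p" "b \<in> Poly_Mapping.keys q"
    using Poly_Mapping.keys_mult[of p q] by blast
  then show "Poly_Mapping.keys e \<subseteq> X \<and> Q'' e"
    using assms by (auto simp: mono_ideal_def keys_add_nat)
qed

lemma carrier_eq_mono_ideal: "carrier (mpoly_ring X) = mono_ideal X (\<lambda>_. True)"
  by (simp add: carrier_mpoly_ring mono_ideal_def)

lemma mono_ideal_add: "p \<in> mono_ideal X Q \<Longrightarrow> q \<in> mono_ideal X Q \<Longrightarrow> p + q \<in> mono_ideal X Q"
  using Poly_Mapping.keys_add[of p q] by (fastforce simp: mono_ideal_def)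

lemma ideal_mono_ideal:
  assumes "\<And>e f. Q e \<Longrightarrow> Poly_Mapping.keys e \<subseteq> X \<Longrightarrow> Poly_Mapping.keys f \<subseteq> X \<Longrightarrow> Q (f + e)"
  shows "ideal (mono_ideal X Q :: ('v, 'k::field) mpoly set) (mpoly_ring X)"
proof (rule ideal_mpoly_ringI)
  fix r p :: "('v, 'k) mpoly" assume "r \<in> carrier (mpoly_ring X)" "p \<in> mono_ideal X Q"
  then show "r * p \<in> mono_ideal X Q"
    unfolding carrier_eq_mono_ideal by (rule mono_ideal_mult[rotated]) (use assms in auto)
qed (auto simp: carrier_mpoly_ring mono_ideal_add, auto simp: mono_ideal_def)

text \<open>Every polynomial is the sum of its terms. The target \<open>S\<close> can be any
  additively closed set, for instance a product of ideals or a linear span.\<close>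

lemma mono_ideal_subsetI:
  fixes S :: "('v, 'k::field) mpoly set"
  assumes "0 \<in> S" "\<And>p q. p \<in> S \<Longrightarrow> q \<in> S \<Longrightarrow> p + q \<in> S"
    and single: "\<And>e c. Poly_Mapping.keys e \<subseteq> X \<Longrightarrow> Q e \<Longrightarrow> Poly_Mapping.single e c \<in> S"
  shows "mono_ideal X Q \<subseteq> S"
proof
  fix p :: "('v, 'k) mpoly" assume p: "p \<in> mono_ideal X Q"
  have sums: "sum f A \<in> S" if "finite A" "\<And>e. e \<in> A \<Longrightarrow> f e \<in> S" for f and A :: "('v \<Rightarrow>\<^sub>0 nat) set"
    using that by (induction A rule: finite_induct) (auto intro: assms)
  show "p \<in> S"
    by (subst poly_mapping_sum_single, rule sums) (use p in \<open>auto simp: mono_ideal_def intro: single\<close>)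
qed

lemma mvmon_in_mono_ideal [simp]:
  "mvmon e \<in> mono_ideal X Q \<longleftrightarrow> Poly_Mapping.keys e \<subseteq> X \<and> Q e"
  by (simp add: mvmon_def mono_ideal_def)

text \<open>\<open>T\<close> may contain 0 next to the monomials because the substitution x = 0
  sends the generators divisible by x to 0.\<close>

lemma genideal_mvmon:
  fixes T :: "('v, 'k::field) mpoly set"
  assumes E: "\<And>e. e \<in> E \<Longrightarrow> Poly_Mapping.keys e \<subseteq> X"
    and T: "mvmon ` E \<subseteq> T" "T \<subseteq> insert 0 (mvmon ` E)"
  shows "genideal (mpoly_ring X) T =
    mono_ideal X (\<lambda>e. \<exists>g\<in>E. \<forall>v. Poly_Mapping.lookup g v \<le> Poly_Mapping.lookup e v)"
    (is "_ = mono_ideal X ?Q")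
proof
  have id: "ideal (mono_ideal X ?Q :: ('v, 'k::field) mpoly set) (mpoly_ring X)"
    by (rule ideal_mono_ideal) (fastforce simp: lookup_add intro: trans_le_add2)
  have "T \<subseteq> mono_ideal X ?Q"
  proof
    fix p assume "p \<in> T"
    then consider "p = 0" | g where "g \<in> E" "p = mvmon g" using T(2) by blast
    then show "p \<in> mono_ideal X ?Q"
      using ideal_mpoly_ring_zero[OF id] E by cases auto
  qed
  then show "genideal (mpoly_ring X) T \<subseteq> mono_ideal X ?Q"
    using ring.genideal_minimal[OF ring_mpoly_ring id] by simp
next
  have Tc: "T \<subseteq> carrier (mpoly_ring X)"
  proof
    fix p assume "p \<in> T"
    then consider "p = 0" | g where "g \<in> E" "p = mvmon g" using T(2) by blast
    then show "p \<in> carrier (mpoly_ring X)"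
      using E by cases (auto simp: carrier_mpoly_ring mvmon_def)
  qed
  note gi = ring.genideal_ideal[OF ring_mpoly_ring Tc]
  show "mono_ideal X ?Q \<subseteq> genideal (mpoly_ring X) T"
  proof (rule mono_ideal_subsetI)
    fix e c assume e: "Poly_Mapping.keys e \<subseteq> X" "?Q e"
    then obtain g where g: "g \<in> E" "\<forall>v. Poly_Mapping.lookup g v \<le> Poly_Mapping.lookup e v" by blast
    have eq: "e = (e - g) + g"
      using g by (intro poly_mapping_eqI) (simp add: lookup_add lookup_minus)
    have "Poly_Mapping.keys (e - g) \<subseteq> X"
      using e eq keys_add_nat by (metis Un_subset_iff)
    then have "Poly_Mapping.single (e - g) c * mvmon g \<in> genideal (mpoly_ring X) T"
      using g T ring.genideal_self[OF ring_mpoly_ring Tc]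
      by (intro ideal_mpoly_ring_mult[OF gi] single_in_carrier_mpoly_ring) auto
    then show "Poly_Mapping.single e c \<in> genideal (mpoly_ring X) T"
      using eq by (simp add: mvmon_def mult_single)
  qed (auto intro: ideal_mpoly_ring_add[OF gi] ideal_mpoly_ring_zero[OF gi])
qed

section \<open>Square-free monomial ideals as edge ideals of hypergraphs\<close>

definition edge_ideal :: "'v set \<Rightarrow> 'v set set \<Rightarrow> ('v, 'k::field) mpoly set" where
  "edge_ideal X F = mono_ideal X (\<lambda>e. \<exists>A\<in>F. A \<subseteq> Poly_Mapping.keys e)"

lemma ideal_edge_ideal: "ideal (edge_ideal X F) (mpoly_ring X)"
  unfolding edge_ideal_def by (rule ideal_mono_ideal) (auto simp: keys_add_nat)

definition ind_exp :: "'v set \<Rightarrow> 'v \<Rightarrow>\<^sub>0 nat" where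
  "ind_exp A = (\<Sum>v\<in>A. Poly_Mapping.single v 1)"

lemma lookup_ind_exp: "finite A \<Longrightarrow> Poly_Mapping.lookup (ind_exp A) v = of_bool (v \<in> A)"
  by (simp add: ind_exp_def lookup_sum lookup_single when_def)

lemma keys_ind_exp [simp]: "finite A \<Longrightarrow> Poly_Mapping.keys (ind_exp A) = A"
  by (auto simp: in_keys_iff lookup_ind_exp)

lemma ind_exp_le_iff:
  "finite A \<Longrightarrow> (\<forall>v. Poly_Mapping.lookup (ind_exp A) v \<le> Poly_Mapping.lookup e v) \<longleftrightarrow> A \<subseteq> Poly_Mapping.keys e"
  by (auto simp: lookup_ind_exp in_keys_iff of_bool_def Suc_le_eq)

lemma ind_exp_keys:
  "(\<And>v. Poly_Mapping.lookup e v \<le> 1) \<Longrightarrow> ind_exp (Poly_Mapping.keys e) = e"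
  by (rule poly_mapping_eqI) (simp add: lookup_ind_exp of_bool_def in_keys_iff le_antisym Suc_le_eq)

lemma genideal_ind_exp:
  assumes "finite X" "F \<subseteq> Pow X" "mvmon ` ind_exp ` F \<subseteq> T" "T \<subseteq> insert 0 (mvmon ` ind_exp ` F)"
  shows "genideal (mpoly_ring X) T = edge_ideal X F"
proof -
  have fin: "finite A" if "A \<in> F" for A
    using that assms(1,2) by (meson PowD finite_subset subsetD)
  have "genideal (mpoly_ring X) T =
      mono_ideal X (\<lambda>e. \<exists>g\<in>ind_exp ` F. \<forall>v. Poly_Mapping.lookup g v \<le> Poly_Mapping.lookup e v)"
  proof (rule genideal_mvmon)
    fix e assume "e \<in> ind_exp ` F"
    then obtain A where "A \<in> F" "e = ind_exp A" by blast
    then show "Poly_Mapping.keys e \<subseteq> X"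
      using fin assms(2) by (simp add: subset_eq)
  qed (use assms in auto)
  also have "(\<lambda>e. \<exists>g\<in>ind_exp ` F. \<forall>v. Poly_Mapping.lookup g v \<le> Poly_Mapping.lookup e v) =
      (\<lambda>e. \<exists>A\<in>F. A \<subseteq> Poly_Mapping.keys e)"
    using ind_exp_le_iff[OF fin] by blast
  also have "mono_ideal X \<dots> = edge_ideal X F"
    by (simp add: edge_ideal_def)
  finally show ?thesis .
qed

lemma squarefree_monomial_ideal_imp_edge_ideal:
  fixes I :: "('v, 'k::field) mpoly set"
  assumes "finite X" "squarefree_monomial_ideal X I"
  shows "\<exists>F\<subseteq>Pow X. I = edge_ideal X F"
proof -
  obtain E where E: "\<And>e. e \<in> E \<Longrightarrow> Poly_Mapping.keys e \<subseteq> X \<and> (\<forall>v. Poly_Mapping.lookup e v \<le> 1)"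
    and I: "I = genideal (mpoly_ring X) (mvmon ` E)"
    using assms(2) unfolding squarefree_monomial_ideal_def by blast
  have "ind_exp ` Poly_Mapping.keys ` E = E"
    using E by (force simp: image_image ind_exp_keys)
  then have "I = edge_ideal X (Poly_Mapping.keys ` E)"
    unfolding I using E assms(1) by (intro genideal_ind_exp) auto
  moreover have "Poly_Mapping.keys ` E \<subseteq> Pow X" using E by auto
  ultimately show ?thesis by blast
qed

text \<open>For finite edges, \<open>packs F t a\<close> says that \<open>x\<^sup>a\<close> lies in the \<open>t\<close>-th power of the edge ideal.\<close>

definition packs :: "'v set set \<Rightarrow> nat \<Rightarrow> ('v \<Rightarrow> nat) \<Rightarrow> bool" where
  "packs F t a \<longleftrightarrow> (\<exists>As. length As = t \<and> set As \<subseteq> F \<and> (\<forall>v. length (filter (\<lambda>A. v \<in> A) As) \<le> a v))"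

lemma packs_0 [simp]: "packs F 0 a"
  by (simp add: packs_def)

lemma packs_mono:
  assumes "packs F t a" "\<And>v. a v \<le> b v" "s \<le> t"
  shows "packs F s b"
proof -
  obtain As where As: "length As = t" "set As \<subseteq> F" "\<forall>v. length (filter (\<lambda>A. v \<in> A) As) \<le> a v"
    using assms unfolding packs_def by blast
  have "length (filter P (take s As)) \<le> length (filter P As)" for P
    by (metis append_take_drop_id filter_append le_add1 length_append)
  then have "length (filter (\<lambda>A. v \<in> A) (take s As)) \<le> b v" for v
    using As(3)[rule_format, of v] assms(2)[of v] by (meson order_trans)
  then show ?thesis
    unfolding packs_def using As assms(3)
    by (intro exI[of _ "take s As"]) (auto dest: in_set_takeD)
qed

text \<open>One edge \<open>A\<close> is split off; \<open>b\<close> bounds the multiplicities of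
  the remaining \<open>t\<close> edges. This recursion mirrors the multiplication of an ideal power
  by one more factor.\<close>

lemma packs_Suc:
  "packs F (Suc t) a \<longleftrightarrow> (\<exists>A\<in>F. \<exists>b. packs F t b \<and> (\<forall>v. b v + of_bool (v \<in> A) \<le> a v))"
proof
  assume "packs F (Suc t) a"
  then obtain A As where "length As = t" "set (A # As) \<subseteq> F"
    "\<forall>v. length (filter (\<lambda>A. v \<in> A) (A # As)) \<le> a v"
    unfolding packs_def by (auto simp: length_Suc_conv)
  then show "\<exists>A\<in>F. \<exists>b. packs F t b \<and> (\<forall>v. b v + of_bool (v \<in> A) \<le> a v)"
    unfolding packs_def
    by (intro bexI[of _ A] exI[of _ "\<lambda>v. length (filter (\<lambda>A. v \<in> A) As)"] conjI exI[of _ As])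
      (auto split: if_splits simp: of_bool_def)
next
  assume "\<exists>A\<in>F. \<exists>b. packs F t b \<and> (\<forall>v. b v + of_bool (v \<in> A) \<le> a v)"
  then obtain A b As where A: "A \<in> F" "\<And>v. b v + of_bool (v \<in> A) \<le> a v" "length As = t" "set As \<subseteq> F"
    "\<And>v. length (filter (\<lambda>A. v \<in> A) As) \<le> b v"
    unfolding packs_def by blast
  have "length (filter (\<lambda>A. v \<in> A) (A # As)) \<le> a v" for v
    using A(2)[of v] A(5)[of v] by (simp add: of_bool_def split: if_splits)
  then show "packs F (Suc t) a"
    unfolding packs_def using A by (intro exI[of _ "A # As"]) auto
qed

lemma ideal_pow_0 [simp]: "ideal_pow R I 0 = carrier R"
  and ideal_pow_Suc: "ideal_pow R I (Suc t) = ideal_prod R (ideal_pow R I t) I"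
  by (simp_all add: ideal_pow_def ideals_set_def nat_pow_def)

text \<open>Induction on \<open>t\<close> along \<open>packs_Suc\<close>: multiplying by an element
  of the edge ideal adds an edge to each exponent, and conversely an edge can be split off from each
  monomial.\<close>

lemma ideal_pow_edge_ideal:
  fixes X :: "'v set"
  assumes "finite X" "F \<subseteq> Pow X"
  shows "ideal_pow (mpoly_ring X) (edge_ideal X F :: ('v, 'k::field) mpoly set) t =
    mono_ideal X (\<lambda>e. packs F t (Poly_Mapping.lookup e))"
proof (induction t)
  case 0
  show ?case by (simp add: carrier_eq_mono_ideal)
next
  case (Suc t)
  let ?R = "mpoly_ring X :: ('v, 'k::field) mpoly ring"
  let ?Q = "\<lambda>t e. packs F t (Poly_Mapping.lookup e)"
  show ?case
    unfolding ideal_pow_Suc Suc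
  proof
    show "ideal_prod ?R (mono_ideal X (?Q t)) (edge_ideal X F) \<subseteq> mono_ideal X (?Q (Suc t))"
    proof
      fix p assume "p \<in> ideal_prod ?R (mono_ideal X (?Q t)) (edge_ideal X F)"
      then show "p \<in> mono_ideal X (?Q (Suc t))"
      proof (induction rule: ideal_prod.induct)
        case (prod i j)
        have "i * j \<in> mono_ideal X (?Q (Suc t))"
        proof (rule mono_ideal_mult[OF _ prod(1) prod(2)[unfolded edge_ideal_def]])
          fix e f :: "'v \<Rightarrow>\<^sub>0 nat"
          assume e: "?Q t e" and "\<exists>A\<in>F. A \<subseteq> Poly_Mapping.keys f"
          then obtain A where A: "A \<in> F" "A \<subseteq> Poly_Mapping.keys f" by blast
          have "Poly_Mapping.lookup e v + of_bool (v \<in> A) \<le> Poly_Mapping.lookup (e + f) v" for v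
            using A by (auto simp: lookup_add of_bool_def in_keys_iff Suc_le_eq)
          with e A show "?Q (Suc t) (e + f)"
            unfolding packs_Suc by blast
        qed
        then show ?case by simp
      qed (simp add: mono_ideal_add)
    qed
  next
    show "mono_ideal X (?Q (Suc t)) \<subseteq> ideal_prod ?R (mono_ideal X (?Q t)) (edge_ideal X F)"
    proof (rule mono_ideal_subsetI)
      have "0 \<in> mono_ideal X (?Q t)" "0 \<in> edge_ideal X F" by (simp_all add: mono_ideal_def edge_ideal_def)
      from ideal_prod.prod[OF this, of ?R] show "0 \<in> ideal_prod ?R (mono_ideal X (?Q t)) (edge_ideal X F)"
        by simp
      show "p + q \<in> ideal_prod ?R (mono_ideal X (?Q t)) (edge_ideal X F)"
        if "p \<in> ideal_prod ?R (mono_ideal X (?Q t)) (edge_ideal X F)"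
          "q \<in> ideal_prod ?R (mono_ideal X (?Q t)) (edge_ideal X F)" for p q
        using ideal_prod.sum[OF that] by simp
    next
      fix e :: "'v \<Rightarrow>\<^sub>0 nat" and c :: 'k
      assume e: "Poly_Mapping.keys e \<subseteq> X" "?Q (Suc t) e"
      then obtain A b where A: "A \<in> F" "packs F t b" "\<And>v. b v + of_bool (v \<in> A) \<le> Poly_Mapping.lookup e v"
        unfolding packs_Suc by blast
      have finA: "finite A" using A(1) assms by (meson PowD finite_subset subsetD)
      \<comment> \<open>The chosen edge fits into \<open>e\<close>, so the truncated subtraction of
        exponents is exact.\<close>
      have eq: "e = (e - ind_exp A) + ind_exp A"
      proof (rule poly_mapping_eqI)
        fix v show "Poly_Mapping.lookup e v = Poly_Mapping.lookup (e - ind_exp A + ind_exp A) v"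
          using A(3)[of v] finA by (simp add: lookup_add lookup_minus lookup_ind_exp)
      qed
      have "Poly_Mapping.keys (e - ind_exp A) \<subseteq> X"
        using e eq keys_add_nat by (metis Un_subset_iff)
      moreover have "?Q t (e - ind_exp A)"
        using A(2)
      proof (rule packs_mono)
        fix v show "b v \<le> Poly_Mapping.lookup (e - ind_exp A) v"
          using A(3)[of v] finA by (simp add: lookup_minus lookup_ind_exp)
      qed simp
      ultimately have 1: "Poly_Mapping.single (e - ind_exp A) c \<in> mono_ideal X (?Q t)"
        by (simp add: mono_ideal_def)
      have "A \<subseteq> X" using A assms by blast
      then have 2: "Poly_Mapping.single (ind_exp A) 1 \<in> edge_ideal X F"
        using A finA by (auto simp: edge_ideal_def mono_ideal_def)
      show "Poly_Mapping.single e c \<in> ideal_prod ?R (mono_ideal X (?Q t)) (edge_ideal X F)"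
        using ideal_prod.prod[OF 1 2, of ?R] eq by (simp add: mult_single)
    qed
  qed
qed

section \<open>Primes generated by variables and their height\<close>

text \<open>Taken as an edge ideal with singleton edges, so that the generation lemma for edge
  ideals applies to it.\<close>

definition var_ideal :: "'v set \<Rightarrow> 'v set \<Rightarrow> ('v, 'k::field) mpoly set" where
  "var_ideal X C = edge_ideal X ((\<lambda>v. {v}) ` C)"

lemma var_ideal_eq: "var_ideal X C = mono_ideal X (\<lambda>e. Poly_Mapping.keys e \<inter> C \<noteq> {})"
proof -
  have "(\<lambda>e. \<exists>A\<in>(\<lambda>v. {v}) ` C. A \<subseteq> Poly_Mapping.keys e) = (\<lambda>e. Poly_Mapping.keys e \<inter> C \<noteq> {})"
    by auto
  then show ?thesis unfolding var_ideal_def edge_ideal_def by (rule arg_cong)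
qed

lemma ideal_var_ideal: "ideal (var_ideal X C) (mpoly_ring X)"
  unfolding var_ideal_def by (rule ideal_edge_ideal)

text \<open>The terms are sorted by whether they involve a variable of \<open>C\<close>;
  \<open>p0\<close> represents \<open>p\<close> in the quotient, which is a polynomial ring in the
  other variables.\<close>

lemma var_ideal_complement_decomp:
  fixes p :: "('v, 'k::field) mpoly"
  assumes "p \<in> carrier (mpoly_ring X)"
  shows "\<exists>p0 p1. p = p0 + p1 \<and> p0 \<in> mono_ideal X (\<lambda>e. Poly_Mapping.keys e \<inter> C = {}) \<and> p1 \<in> var_ideal X C"
proof -
  let ?M = "mono_ideal X (\<lambda>e. Poly_Mapping.keys e \<inter> C = {}) :: ('v, 'k) mpoly set"
  let ?V = "var_ideal X C :: ('v, 'k) mpoly set"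
  let ?S = "{p. \<exists>p0 p1. p = p0 + p1 \<and> p0 \<in> ?M \<and> p1 \<in> ?V}"
  have z: "0 \<in> ?M" "0 \<in> ?V" by (simp_all add: mono_ideal_def var_ideal_eq)
  have "mono_ideal X (\<lambda>_. True) \<subseteq> ?S"
  proof (rule mono_ideal_subsetI)
    show "0 \<in> ?S" using z by (metis (mono_tags, lifting) add_0 mem_Collect_eq)
  next
    fix p q assume "p \<in> ?S" "q \<in> ?S"
    then obtain p0 p1 q0 q1 where *: "p = p0 + p1" "p0 \<in> ?M" "p1 \<in> ?V" "q = q0 + q1" "q0 \<in> ?M" "q1 \<in> ?V"
      by blast
    have "p + q = (p0 + q0) + (p1 + q1)" using * by (simp add: algebra_simps)
    moreover have "p0 + q0 \<in> ?M" "p1 + q1 \<in> ?V"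
      using * by (auto simp: var_ideal_eq intro: mono_ideal_add)
    ultimately show "p + q \<in> ?S" by blast
  next
    fix e :: "'v \<Rightarrow>\<^sub>0 nat" and c :: 'k
    assume e: "Poly_Mapping.keys e \<subseteq> X"
    show "Poly_Mapping.single e c \<in> ?S"
    proof (cases "Poly_Mapping.keys e \<inter> C = {}")
      case True
      then have "Poly_Mapping.single e c \<in> ?M" using e by (simp add: mono_ideal_def)
      then show ?thesis using z by (metis (mono_tags, lifting) add_0_right mem_Collect_eq)
    next
      case False
      then have "Poly_Mapping.single e c \<in> ?V" using e by (simp add: mono_ideal_def var_ideal_eq)
      then show ?thesis using z by (metis (mono_tags, lifting) add_0 mem_Collect_eq)
    qed
  qed
  then show ?thesis using assms unfolding carrier_eq_mono_ideal by blast
qed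

text \<open>Modulo the ideal each factor reduces to its part free of \<open>C\<close>. The product
  of these parts is free of \<open>C\<close> as well, so it lies in the ideal only if it is
  0.\<close>

lemma primeideal_var_ideal:
  fixes X C :: "'v::linorder set"
  shows "primeideal (var_ideal X C :: ('v, 'k::field) mpoly set) (mpoly_ring X)"
proof (rule primeidealI)
  let ?V = "var_ideal X C :: ('v, 'k) mpoly set"
  let ?R = "mpoly_ring X :: ('v, 'k) mpoly ring"
  show "ideal ?V ?R" by (rule ideal_var_ideal)
  show "cring ?R" by (rule cring_mpoly_ring)
  have "(1 :: ('v, 'k) mpoly) \<in> carrier ?R" "(1 :: ('v, 'k) mpoly) \<notin> ?V"
    by (simp_all add: carrier_mpoly_ring var_ideal_eq mono_ideal_def)
  then show "carrier ?R \<noteq> ?V" by blast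
  fix a b :: "('v, 'k) mpoly"
  assume ab: "a \<in> carrier ?R" "b \<in> carrier ?R" "a \<otimes>\<^bsub>?R\<^esub> b \<in> ?V"
  let ?M = "mono_ideal X (\<lambda>e. Poly_Mapping.keys e \<inter> C = {}) :: ('v, 'k) mpoly set"
  obtain a0 a1 where a: "a = a0 + a1" "a0 \<in> ?M" "a1 \<in> ?V"
    using var_ideal_complement_decomp[OF ab(1)] by blast
  obtain b0 b1 where b: "b = b0 + b1" "b0 \<in> ?M" "b1 \<in> ?V"
    using var_ideal_complement_decomp[OF ab(2)] by blast
  have a0c: "a0 \<in> carrier ?R" using a by (simp add: carrier_mpoly_ring mono_ideal_def)
  have "b * a1 \<in> ?V" "a0 * b1 \<in> ?V"
    using ideal_mpoly_ring_mult[OF ideal_var_ideal] a b ab a0c by auto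
  then have "a * b - b * a1 - a0 * b1 \<in> ?V"
    using ab(3) by (auto intro: ideal_mpoly_ring_diff[OF ideal_var_ideal])
  moreover have "a * b - b * a1 - a0 * b1 = a0 * b0"
    by (simp add: a b algebra_simps)
  ultimately have "a0 * b0 \<in> ?V" by simp
  moreover have "a0 * b0 \<in> ?M"
    by (rule mono_ideal_mult[OF _ a(2) b(2)]) (auto simp: keys_add_nat)
  ultimately have "Poly_Mapping.keys (a0 * b0) = {}"
    by (auto simp: var_ideal_eq mono_ideal_def)
  then have "a0 * b0 = 0" by simp
  \<comment> \<open>The absence of zero divisors comes from the linear order on the type of
    variables.\<close>
  then have "a0 = 0 \<or> b0 = 0" by simp
  then show "a \<in> ?V \<or> b \<in> ?V" using a b by auto
qed

section \<open>Linear independence modulo an ideal and the upper bound for heights\<close>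

definition indep_mod :: "('v, 'k::field) mpoly set \<Rightarrow> ('v, 'k) mpoly set \<Rightarrow> bool" where
  "indep_mod Q G \<longleftrightarrow> finite G \<and>
     (\<forall>c. (\<Sum>g\<in>G. Poly_Mapping.single 0 (c g) * g) \<in> Q \<longrightarrow> (\<forall>g\<in>G. c g = 0))"

lemma single_0_mult_in_carrier:
  fixes g :: "('v, 'k::field) mpoly"
  shows "g \<in> carrier (mpoly_ring X) \<Longrightarrow> Poly_Mapping.single 0 c * g \<in> carrier (mpoly_ring X)"
  using mono_ideal_mult[of "\<lambda>_. True" "\<lambda>_. True" X "\<lambda>_. True" "Poly_Mapping.single 0 c" g]
  by (simp add: carrier_eq_mono_ideal) (simp add: mono_ideal_def)

lemma carrier_mpoly_ring_closed:
  fixes p q :: "('v, 'k::field) mpoly"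
  assumes "p \<in> carrier (mpoly_ring X)" "q \<in> carrier (mpoly_ring X)"
  shows "p + q \<in> carrier (mpoly_ring X)" "p * q \<in> carrier (mpoly_ring X)"
    "p ^ n \<in> carrier (mpoly_ring X)"
proof -
  have *: "p * q \<in> carrier (mpoly_ring X)" if "p \<in> carrier (mpoly_ring X)" "q \<in> carrier (mpoly_ring X)"
    for p q :: "('v, 'k::field) mpoly"
    using that mono_ideal_mult[of "\<lambda>_. True" "\<lambda>_. True" X "\<lambda>_. True" p q] by (simp add: carrier_eq_mono_ideal)
  show "p * q \<in> carrier (mpoly_ring X)" by (rule *[OF assms])
  show "p + q \<in> carrier (mpoly_ring X)"
    using assms by (simp add: carrier_eq_mono_ideal mono_ideal_add)
  show "p ^ n \<in> carrier (mpoly_ring X)"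
    using assms(1) by (induction n) (auto intro: *, simp add: carrier_mpoly_ring)
qed

lemma carrier_mpoly_ring_sum:
  fixes f :: "'i \<Rightarrow> ('v, 'k::field) mpoly"
  shows "(\<And>i. i \<in> A \<Longrightarrow> f i \<in> carrier (mpoly_ring X)) \<Longrightarrow> sum f A \<in> carrier (mpoly_ring X)"
proof (induction A rule: infinite_finite_induct)
  case (insert x F)
  then show ?case by (auto intro!: carrier_mpoly_ring_closed)
qed (simp_all add: carrier_mpoly_ring)

text \<open>Modulo \<open>Q\<close> only the terms with \<open>j = 0\<close> survive, and
  independence modulo \<open>Q\<close> kills their coefficients. What remains is a multiple of
  \<open>f\<close>, and \<open>f\<close> can be cancelled because \<open>P\<close> is prime and
  \<open>f\<close> lies outside \<open>P\<close>.\<close>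

lemma indep_family_powers:
  fixes P Q :: "('v, 'k::field) mpoly set"
  assumes P: "primeideal P (mpoly_ring X)" and Q: "ideal Q (mpoly_ring X)" and PQ: "P \<subseteq> Q"
    and f: "f \<in> Q" "f \<notin> P"
    and G: "G \<subseteq> carrier (mpoly_ring X)" "indep_mod Q G"
    and sum: "(\<Sum>j\<le>N. (\<Sum>g\<in>G. Poly_Mapping.single 0 (c g j) * g) * f ^ j) \<in> P"
    and "g \<in> G" "j \<le> N"
  shows "c g j = 0"
  using sum \<open>j \<le> N\<close>
proof (induction N arbitrary: c j)
  case 0
  then have "(\<Sum>g\<in>G. Poly_Mapping.single 0 (c g 0) * g) \<in> Q" using PQ by auto
  then show ?case
    using G(2)[unfolded indep_mod_def, THEN conjunct2, rule_format, of "\<lambda>g. c g 0"] \<open>g \<in> G\<close> 0 by simp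
next
  case (Suc N)
  interpret P: primeideal P "mpoly_ring X" by (rule P)
  note fc = subsetD[OF ideal_mpoly_ring_sub[OF Q] f(1)]
  define h where "h j = (\<Sum>g\<in>G. Poly_Mapping.single 0 (c g j) * g)" for j
  define s where "s = (\<Sum>j\<le>N. h (Suc j) * f ^ j)"
  have hc: "h j \<in> carrier (mpoly_ring X)" for j
    unfolding h_def using G by (auto intro!: carrier_mpoly_ring_sum single_0_mult_in_carrier)
  have sc: "s \<in> carrier (mpoly_ring X)"
    unfolding s_def using hc fc by (auto intro!: carrier_mpoly_ring_sum carrier_mpoly_ring_closed)
  have eq: "(\<Sum>j\<le>Suc N. h j * f ^ j) = h 0 + s * f"
    unfolding s_def by (subst sum.atMost_Suc_shift) (simp add: sum_distrib_left algebra_simps)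
  have tot: "h 0 + s * f \<in> P"
    using Suc.prems(1) unfolding h_def[symmetric] eq .
  then have "h 0 + s * f \<in> Q" "s * f \<in> Q"
    using PQ ideal_mpoly_ring_mult[OF Q f(1) sc] by auto
  then have "h 0 \<in> Q"
    using ideal_mpoly_ring_diff[OF Q, of "h 0 + s * f" "s * f"] by simp
  then have c0: "\<forall>g\<in>G. c g 0 = 0"
    using G(2) unfolding indep_mod_def h_def by auto
  then have "h 0 = 0" unfolding h_def by simp
  then have "s \<in> P" using tot P.I_prime[OF sc fc] f(2) by auto
  then have "c g (Suc i) = 0" if "i \<le> N" for i
    using Suc.IH[of "\<lambda>g j. c g (Suc j)" i] that unfolding s_def h_def by simp
  then show ?case using c0 \<open>g \<in> G\<close> Suc.prems(2) by (cases j) auto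
qed

text \<open>Passes from the family indexed by pairs to the set of products. Each step down in a
  chain of primes thus gains a factor \<open>N + 1\<close> in the number of independent
  elements.\<close>

lemma indep_mod_powers:
  fixes N :: nat and P Q :: "('v, 'k::field) mpoly set"
  assumes P: "primeideal P (mpoly_ring X)" and Q: "ideal Q (mpoly_ring X)" and PQ: "P \<subseteq> Q"
    and f: "f \<in> Q" "f \<notin> P"
    and G: "G \<subseteq> carrier (mpoly_ring X)" "indep_mod Q G"
  defines "G' \<equiv> (\<lambda>(g, j). g * f ^ j) ` (G \<times> {..N})"
  shows "indep_mod P G'" "card G' = card G * (N + 1)"
proof -
  let ?\<phi> = "\<lambda>(g, j). g * f ^ j"
  have fin: "finite G" using G(2) by (simp add: indep_mod_def)
  have fam: "c g j = 0"
    if "(\<Sum>x\<in>G \<times> {..N}. Poly_Mapping.single 0 (case x of (g, j) \<Rightarrow> c g j) * ?\<phi> x) \<in> P" "g \<in> G" "j \<le> N"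
    for c and g :: "('v, 'k) mpoly" and j
  proof (rule indep_family_powers[OF P Q PQ f G _ that(2,3)])
    have "(\<Sum>x\<in>G \<times> {..N}. Poly_Mapping.single 0 (case x of (g, j) \<Rightarrow> c g j) * ?\<phi> x) =
        (\<Sum>g\<in>G. \<Sum>j\<le>N. Poly_Mapping.single 0 (c g j) * (g * f ^ j))"
      by (simp add: sum.cartesian_product case_prod_unfold)
    also have "\<dots> = (\<Sum>j\<le>N. (\<Sum>g\<in>G. Poly_Mapping.single 0 (c g j) * g) * f ^ j)"
      by (subst sum.swap) (simp add: sum_distrib_right mult.assoc)
    finally show "(\<Sum>j\<le>N. (\<Sum>g\<in>G. Poly_Mapping.single 0 (c g j) * g) * f ^ j) \<in> P"
      using that(1) by simp
  qed
  interpret P: primeideal P "mpoly_ring X" by (rule P)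
  have inj: "inj_on ?\<phi> (G \<times> {..N})"
  proof (rule inj_onI)
    fix x y assume x: "x \<in> G \<times> {..N}" and y: "y \<in> G \<times> {..N}" and eq: "?\<phi> x = ?\<phi> y"
    show "x = y"
    proof (rule ccontr)
      assume "x \<noteq> y"
      \<comment> \<open>Two pairs with the same product would give a nontrivial relation with
        coefficients 1 and -1.\<close>
      define c where "c g j = (if (g, j) = x then 1 else if (g, j) = y then - 1 else (0 :: 'k))" for g j
      have "(\<Sum>z\<in>G \<times> {..N}. Poly_Mapping.single 0 (case z of (g, j) \<Rightarrow> c g j) * ?\<phi> z) =
          (\<Sum>z\<in>{x, y}. Poly_Mapping.single 0 (case z of (g, j) \<Rightarrow> c g j) * ?\<phi> z)"
        by (rule sum.mono_neutral_right) (use x y fin in \<open>auto simp: c_def\<close>)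
      also have "\<dots> = 0"
        using \<open>x \<noteq> y\<close> eq by (auto simp: c_def single_uminus)
      also have "0 \<in> P" using ideal_mpoly_ring_zero[OF P.is_ideal] .
      finally have "c (fst x) (snd x) = 0"
        using fam[of c "fst x" "snd x"] x by auto
      then show False by (simp add: c_def)
    qed
  qed
  show "card G' = card G * (N + 1)"
    unfolding G'_def by (simp add: card_image[OF inj] card_cartesian_product)
  show "indep_mod P G'"
    unfolding indep_mod_def
  proof (intro conjI allI impI ballI)
    show "finite G'" unfolding G'_def using fin by blast
    fix c x assume sum: "(\<Sum>g\<in>G'. Poly_Mapping.single 0 (c g) * g) \<in> P" and x: "x \<in> G'"
    then obtain g j where gj: "g \<in> G" "j \<le> N" "x = g * f ^ j" unfolding G'_def by auto
    have "(\<Sum>g\<in>G'. Poly_Mapping.single 0 (c g) * g) =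
        (\<Sum>x\<in>G \<times> {..N}. Poly_Mapping.single 0 (case x of (g, j) \<Rightarrow> c (g * f ^ j)) * ?\<phi> x)"
      unfolding G'_def by (subst sum.reindex[OF inj]) (simp add: case_prod_unfold)
    then show "c x = 0"
      using fam[of "\<lambda>g j. c (g * f ^ j)" g j] sum gj by simp
  qed
qed

definition bounded_exps :: "'v set \<Rightarrow> nat \<Rightarrow> ('v \<Rightarrow>\<^sub>0 nat) set" where
  "bounded_exps Y N = {e. Poly_Mapping.keys e \<subseteq> Y \<and> (\<forall>v. Poly_Mapping.lookup e v \<le> N)}"

lemma card_bounded_exps:
  assumes "finite Y"
  shows "finite (bounded_exps Y N)" "card (bounded_exps Y N) = (N + 1) ^ card Y"
proof -
  have "bij_betw (\<lambda>e. restrict (Poly_Mapping.lookup e) Y) (bounded_exps Y N) (PiE Y (\<lambda>_. {..N}))"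
    unfolding bij_betw_def
  proof
    show "inj_on (\<lambda>e. restrict (Poly_Mapping.lookup e) Y) (bounded_exps Y N)"
    proof (rule inj_onI, rule poly_mapping_eqI)
      fix e e' v assume *: "e \<in> bounded_exps Y N" "e' \<in> bounded_exps Y N"
        "restrict (Poly_Mapping.lookup e) Y = restrict (Poly_Mapping.lookup e') Y"
      show "Poly_Mapping.lookup e v = Poly_Mapping.lookup e' v"
      proof (cases "v \<in> Y")
        case True
        then show ?thesis using fun_cong[OF *(3), of v] by simp
      next
        case False
        then have "v \<notin> Poly_Mapping.keys e" "v \<notin> Poly_Mapping.keys e'" using * by (auto simp: bounded_exps_def)
        then show ?thesis by (simp add: in_keys_iff)
      qed
    qed
    show "(\<lambda>e. restrict (Poly_Mapping.lookup e) Y) ` bounded_exps Y N = PiE Y (\<lambda>_. {..N})"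
    proof (intro equalityI subsetI)
      fix \<phi> assume \<phi>: "\<phi> \<in> PiE Y (\<lambda>_. {..N})"
      define e where "e = (\<Sum>v\<in>Y. Poly_Mapping.single v (\<phi> v))"
      have l: "Poly_Mapping.lookup e v = (if v \<in> Y then \<phi> v else 0)" for v
        using assms by (simp add: e_def lookup_sum lookup_single when_def)
      have "e \<in> bounded_exps Y N" using \<phi> by (auto simp: bounded_exps_def in_keys_iff l split: if_splits)
      moreover have "restrict (Poly_Mapping.lookup e) Y = \<phi>"
      proof
        fix v show "restrict (Poly_Mapping.lookup e) Y v = \<phi> v"
          using PiE_arb[OF \<phi>, of v] by (simp add: l restrict_def)
      qed
      ultimately show "\<phi> \<in> (\<lambda>e. restrict (Poly_Mapping.lookup e) Y) ` bounded_exps Y N" by blast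
    qed (auto simp: bounded_exps_def)
  qed
  moreover have "finite (PiE Y (\<lambda>_. {..N}))" "card (PiE Y (\<lambda>_. {..N})) = (N + 1) ^ card Y"
    using assms by (auto simp: finite_PiE card_PiE)
  ultimately show "finite (bounded_exps Y N)" "card (bounded_exps Y N) = (N + 1) ^ card Y"
    by (auto simp: bij_betw_finite bij_betw_same_card)
qed

lemma inj_mvmon: "inj (mvmon :: _ \<Rightarrow> ('v, 'k::field) mpoly)"
  unfolding mvmon_def inj_def by (metis keys_single one_neq_zero singleton_inject)

lemma lookup_smult_mvmon:
  "Poly_Mapping.single 0 c * mvmon e = Poly_Mapping.single e c"
  by (simp add: mvmon_def mult_single)

text \<open>Every term of an element of the ideal involves a variable of \<open>C\<close>, while the
  monomials here involve none; so their coefficients can be read off and vanish.\<close>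

lemma indep_mod_var_ideal:
  assumes "finite X" "C \<subseteq> X"
  shows "indep_mod (var_ideal X C) (mvmon ` bounded_exps (X - C) N :: ('v, 'k::field) mpoly set)"
  unfolding indep_mod_def
proof (intro conjI allI impI ballI)
  show "finite (mvmon ` bounded_exps (X - C) N)" using assms card_bounded_exps by blast
  fix c :: "('v, 'k) mpoly \<Rightarrow> 'k" and g
  assume sum: "(\<Sum>g\<in>mvmon ` bounded_exps (X - C) N. Poly_Mapping.single 0 (c g) * g) \<in> var_ideal X C"
    and "g \<in> (mvmon ` bounded_exps (X - C) N :: ('v, 'k) mpoly set)"
  then obtain e where e: "e \<in> bounded_exps (X - C) N" "g = mvmon e" by blast
  have "(\<Sum>g\<in>mvmon ` bounded_exps (X - C) N. Poly_Mapping.single 0 (c g) * g) =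
      (\<Sum>e\<in>bounded_exps (X - C) N. Poly_Mapping.single e (c (mvmon e)))"
    by (subst sum.reindex) (auto intro: inj_on_subset[OF inj_mvmon] simp: lookup_smult_mvmon)
  moreover have "Poly_Mapping.lookup (\<Sum>e\<in>bounded_exps (X - C) N. Poly_Mapping.single e (c (mvmon e))) e = c (mvmon e)"
    using e card_bounded_exps(1)[of "X - C" N] assms by (simp add: lookup_sum lookup_single when_def)
  moreover have "Poly_Mapping.keys e \<inter> C = {}" using e by (auto simp: bounded_exps_def)
  ultimately show "c g = 0"
    using sum e unfolding var_ideal_eq mono_ideal_def by (auto simp: in_keys_iff)
qed

lemma vector_space_mpoly:
  "vector_space (\<lambda>(c::'k::field) (p :: ('v, 'k) mpoly). Poly_Mapping.single 0 c * p)"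
proof (rule vector_space.intro)
  fix a b :: 'k and x :: "('v, 'k) mpoly"
  show "Poly_Mapping.single 0 (a + b) * x = Poly_Mapping.single 0 a * x + Poly_Mapping.single 0 b * x"
    by (simp only: single_add distrib_right)
  show "Poly_Mapping.single 0 a * (Poly_Mapping.single 0 b * x) = Poly_Mapping.single 0 (a * b) * x"
    by (simp only: mult.assoc[symmetric] mult_single add_0_left)
qed (simp_all add: distrib_left)

text \<open>Independence modulo \<open>Q\<close> implies independence over the field, since 0 lies
  in \<open>Q\<close>; the number of spanning monomials then bounds the count.\<close>

lemma indep_mod_card_le:
  fixes G :: "('v, 'k::field) mpoly set"
  assumes "finite X" "0 \<in> Q" "indep_mod Q G"
    and G: "G \<subseteq> mono_ideal X (\<lambda>e. \<forall>v. Poly_Mapping.lookup e v \<le> K)"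
  shows "card G \<le> (K + 1) ^ card X"
proof -
  define sc where "sc = (\<lambda>(c::'k) (p :: ('v, 'k) mpoly). Poly_Mapping.single 0 c * p)"
  interpret vs: vector_space sc
    unfolding sc_def by (rule vector_space_mpoly)
  let ?T = "mvmon ` bounded_exps X K :: ('v, 'k) mpoly set"
  have "vs.independent G"
  proof (rule vs.independent_if_scalars_zero)
    fix c :: "('v, 'k) mpoly \<Rightarrow> 'k" and g
    assume c: "(\<Sum>x\<in>G. sc (c x) x) = 0" and g: "g \<in> G"
    then have "(\<Sum>x\<in>G. Poly_Mapping.single 0 (c x) * x) \<in> Q"
      using assms(2) by (simp add: sc_def)
    then show "c g = 0" using assms(3) g unfolding indep_mod_def by blast
  qed (use assms in \<open>simp add: indep_mod_def\<close>)
  moreover have "G \<subseteq> vs.span ?T"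
  proof (rule order_trans[OF G], rule mono_ideal_subsetI)
    fix e :: "'v \<Rightarrow>\<^sub>0 nat" and c :: 'k
    assume "Poly_Mapping.keys e \<subseteq> X" "\<forall>v. Poly_Mapping.lookup e v \<le> K"
    then have "mvmon e \<in> vs.span ?T" by (intro vs.span_base) (simp add: bounded_exps_def)
    from vs.span_scale[OF this, of c] show "Poly_Mapping.single e c \<in> vs.span ?T"
      by (simp add: sc_def lookup_smult_mvmon)
  qed (auto intro: vs.span_add vs.span_zero)
  ultimately have "card G \<le> card ?T"
    using vs.independent_span_bound[of ?T G] card_bounded_exps(1)[OF assms(1)] by blast
  also have "\<dots> \<le> (K + 1) ^ card X"
    using card_bounded_exps[OF assms(1), of K] by (metis card_image_le)
  finally show ?thesis .
qed

lemma ex_exponent_bound: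
  fixes f :: "('v, 'k::field) mpoly"
  assumes "f \<in> carrier (mpoly_ring X)"
  shows "\<exists>B. f \<in> mono_ideal X (\<lambda>e. \<forall>v. Poly_Mapping.lookup e v \<le> B)"
proof -
  have "finite (\<Union>e\<in>Poly_Mapping.keys f. Poly_Mapping.range e)" by simp
  then obtain B where B: "\<forall>n\<in>(\<Union>e\<in>Poly_Mapping.keys f. Poly_Mapping.range e). n \<le> B"
    using finite_nat_set_iff_bounded_le by blast
  have "Poly_Mapping.lookup e v \<le> B" if "e \<in> Poly_Mapping.keys f" for e v
  proof (cases "v \<in> Poly_Mapping.keys e")
    case True
    then have "Poly_Mapping.lookup e v \<in> (\<Union>e\<in>Poly_Mapping.keys f. Poly_Mapping.range e)"
      by (intro UN_I[OF that]) simp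
    then show ?thesis by (rule B[rule_format])
  qed (simp add: in_keys_iff)
  then show ?thesis using assms by (auto simp: mono_ideal_def carrier_mpoly_ring)
qed

lemma power_exponent_bound:
  fixes f :: "('v, 'k::field) mpoly"
  assumes "f \<in> mono_ideal X (\<lambda>e. \<forall>v. Poly_Mapping.lookup e v \<le> B)"
  shows "f ^ j \<in> mono_ideal X (\<lambda>e. \<forall>v. Poly_Mapping.lookup e v \<le> j * B)"
proof (induction j)
  case (Suc j)
  have "f * f ^ j \<in> mono_ideal X (\<lambda>e. \<forall>v. Poly_Mapping.lookup e v \<le> Suc j * B)"
  proof (rule mono_ideal_mult[OF _ assms Suc], rule allI)
    fix e f :: "'v \<Rightarrow>\<^sub>0 nat" and v
    assume "\<forall>v. Poly_Mapping.lookup e v \<le> B" "\<forall>v. Poly_Mapping.lookup f v \<le> j * B"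
    then show "Poly_Mapping.lookup (e + f) v \<le> Suc j * B"
      unfolding lookup_add mult_Suc by (blast intro: add_mono)
  qed
  then show ?case by simp
qed (simp add: mono_ideal_def)

text \<open>Given a chain \<open>P\<^sub>0 \<subset> \<dots> \<subset> P\<^sub>m = (x\<^sub>i : i \<in> C)\<close> and \<open>f\<^sub>i \<in> P\<^sub>i - P\<^sub>i\<^sub>-\<^sub>1\<close>, the products of
  monomials in the variables outside \<open>C\<close> with powers of the \<open>f\<^sub>i\<close> are linearly independent modulo
  \<open>P\<^sub>0\<close>. Counting those with exponents at most \<open>N\<close> against all monomials of exponents \<open>O(N)\<close> gives
  \<open>m \<le> card C\<close>, without dimension theory.\<close>

lemma chain_to_var_ideal:
  fixes P :: "nat \<Rightarrow> ('v, 'k::field) mpoly set"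
  assumes X: "finite X" "C \<subseteq> X"
    and prime: "\<And>i. i \<le> m \<Longrightarrow> primeideal (P i) (mpoly_ring X)"
    and sub: "\<And>i. i < m \<Longrightarrow> P i \<subset> P (Suc i)" and top: "P m = var_ideal X C"
    and "k \<le> m"
  shows "\<exists>B. \<forall>N. \<exists>G. G \<subseteq> mono_ideal X (\<lambda>e. \<forall>v. Poly_Mapping.lookup e v \<le> N * B) \<and>
     indep_mod (P (m - k)) G \<and> card G = (N + 1) ^ (card (X - C) + k)"
  using \<open>k \<le> m\<close>
proof (induction k)
  case 0
  have "mvmon ` bounded_exps (X - C) N \<subseteq> (mono_ideal X (\<lambda>e. \<forall>v. Poly_Mapping.lookup e v \<le> N * 1) :: ('v, 'k) mpoly set)" for N
    by (auto simp: bounded_exps_def)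
  moreover have "card (mvmon ` bounded_exps (X - C) N :: ('v, 'k) mpoly set) = (N + 1) ^ card (X - C)" for N
    using X card_bounded_exps(2)[of "X - C" N] by (simp add: card_image[OF inj_on_subset[OF inj_mvmon]])
  ultimately have "\<exists>G. G \<subseteq> mono_ideal X (\<lambda>e. \<forall>v. Poly_Mapping.lookup e v \<le> N * 1) \<and>
     indep_mod (P (m - 0)) G \<and> card G = (N + 1) ^ (card (X - C) + 0)" for N
    using indep_mod_var_ideal[OF X, of N] top
    by (intro exI[of _ "mvmon ` bounded_exps (X - C) N"]) simp
  then show ?case by blast
next
  case (Suc k)
  then obtain B where B: "\<And>N. \<exists>G. G \<subseteq> mono_ideal X (\<lambda>e. \<forall>v. Poly_Mapping.lookup e v \<le> N * B) \<and>
     indep_mod (P (m - k)) G \<and> card G = (N + 1) ^ (card (X - C) + k)" by auto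
  \<comment> \<open>The induction goes down the chain, from \<open>P (Suc i)\<close> to
    \<open>P i\<close>; the new exponent bound adds up those of \<open>G\<close> and of the powers
    of \<open>f\<close>.\<close>
  define i where "i = m - Suc k"
  have i: "Suc i = m - k" "i < m" using Suc.prems by (auto simp: i_def)
  obtain f where f: "f \<in> P (Suc i)" "f \<notin> P i" using sub[OF i(2)] by blast
  have Pi: "primeideal (P i) (mpoly_ring X)" using prime i(2) by simp
  have Psi: "ideal (P (Suc i)) (mpoly_ring X)" using prime[of "Suc i"] i(2) by (simp add: primeideal.axioms(1))
  obtain Bf where Bf: "f \<in> mono_ideal X (\<lambda>e. \<forall>v. Poly_Mapping.lookup e v \<le> Bf)"
    using ex_exponent_bound ideal_mpoly_ring_sub[OF Psi] f(1) by blast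
  have "\<exists>G. G \<subseteq> mono_ideal X (\<lambda>e. \<forall>v. Poly_Mapping.lookup e v \<le> N * (B + Bf)) \<and>
     indep_mod (P i) G \<and> card G = (N + 1) ^ (card (X - C) + Suc k)" for N
  proof -
    obtain G where G: "G \<subseteq> mono_ideal X (\<lambda>e. \<forall>v. Poly_Mapping.lookup e v \<le> N * B)"
      "indep_mod (P (Suc i)) G" "card G = (N + 1) ^ (card (X - C) + k)"
      using B unfolding i(1) by blast
    have Gc: "G \<subseteq> carrier (mpoly_ring X)"
      using G(1) by (auto simp: carrier_mpoly_ring mono_ideal_def)
    define G' where "G' = (\<lambda>(g, j). g * f ^ j) ` (G \<times> {..N})"
    note G' = indep_mod_powers[OF Pi Psi _ f Gc G(2), of N, folded G'_def]
    have "G' \<subseteq> mono_ideal X (\<lambda>e. \<forall>v. Poly_Mapping.lookup e v \<le> N * (B + Bf))"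
    proof
      fix x assume "x \<in> G'"
      then obtain g j where gj: "g \<in> G" "j \<le> N" "x = g * f ^ j" unfolding G'_def by auto
      have *: "a + b \<le> N * (B + Bf)" if "a \<le> N * B" "b \<le> j * Bf" for a b
      proof -
        have "j * Bf \<le> N * Bf" using gj(2) by simp
        then show ?thesis using that unfolding distrib_left by linarith
      qed
      show "x \<in> mono_ideal X (\<lambda>e. \<forall>v. Poly_Mapping.lookup e v \<le> N * (B + Bf))"
        unfolding gj(3)
      proof (rule mono_ideal_mult[OF _ subsetD[OF G(1) gj(1)] power_exponent_bound[OF Bf]], rule allI)
        fix a b :: "'v \<Rightarrow>\<^sub>0 nat" and v
        assume "\<forall>v. Poly_Mapping.lookup a v \<le> N * B" "\<forall>v. Poly_Mapping.lookup b v \<le> j * Bf"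
        then show "Poly_Mapping.lookup (a + b) v \<le> N * (B + Bf)"
          unfolding lookup_add by (intro *) auto
      qed
    qed
    then show ?thesis
      using G' sub[OF i(2)] G(3) by (intro exI[of _ G']) auto
  qed
  then show ?case unfolding i_def by blast
qed

text \<open>A chain of length \<open>m\<close> yields \<open>(N + 1) ^ (card (X - C) + m)\<close>
  independent polynomials in a space of dimension at most \<open>(N * B + 1) ^ card X\<close>, for
  every \<open>N\<close>. Comparing the growth in \<open>N\<close> gives
  \<open>m \<le> card C\<close>.\<close>

lemma prime_height_var_ideal_le:
  fixes X C :: "'v set"
  assumes X: "finite X" "C \<subseteq> X"
  shows "prime_height (mpoly_ring X) (var_ideal X C :: ('v, 'k::field) mpoly set) \<le> enat (card C)"
  unfolding prime_height_def
proof (rule Sup_least, clarify)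
  fix m and P :: "nat \<Rightarrow> ('v, 'k) mpoly set"
  assume P: "\<forall>i\<le>m. primeideal (P i) (mpoly_ring X)" "\<forall>i<m. P i \<subset> P (Suc i)" "P m = var_ideal X C"
  obtain B where B: "\<And>N. \<exists>G. G \<subseteq> mono_ideal X (\<lambda>e. \<forall>v. Poly_Mapping.lookup e v \<le> N * B) \<and>
     indep_mod (P 0) G \<and> card G = (N + 1) ^ (card (X - C) + m)"
    using chain_to_var_ideal[OF X, of m P m] P by auto
  have z: "0 \<in> P 0"
    using P(1) by (auto intro: ideal_mpoly_ring_zero primeideal.axioms(1))
  have le: "(N + 1) ^ (card (X - C) + m) \<le> (N * B + 1) ^ card X" for N
    using B[of N] indep_mod_card_le[OF X(1) z] by metis
  have "m \<le> card C"
  proof (rule ccontr)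
    assume "\<not> m \<le> card C"
    moreover have "card X = card (X - C) + card C"
      using X by (metis card_Diff_subset card_mono finite_subset le_add_diff_inverse2)
    ultimately have d: "Suc (card X) \<le> card (X - C) + m" by simp
    \<comment> \<open>For this \<open>N\<close> the space has dimension at most
      \<open>N * (N + 1) ^ card X\<close>, less than the \<open>(N + 1) * (N + 1) ^ card X\<close>
      independent elements that a longer chain would provide.\<close>
    define N where "N = (B + 1) ^ card X"
    have "(N + 1) * (N + 1) ^ card X \<le> (N + 1) ^ (card (X - C) + m)"
      using power_increasing[OF d, of "N + 1"] by simp
    also note le
    also have "(N * B + 1) ^ card X \<le> ((B + 1) * (N + 1)) ^ card X"
      by (rule power_mono) (simp_all add: algebra_simps)
    also have "\<dots> = N * (N + 1) ^ card X"
      unfolding power_mult_distrib N_def ..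
    finally show False by simp
  qed
  then show "enat m \<le> enat (card C)" by simp
qed

section \<open>Lower bound for heights and the height of an edge ideal\<close>

lemma var_in_var_ideal: "var v \<in> var_ideal X C \<longleftrightarrow> v \<in> X \<and> v \<in> C"
  by (simp add: var_def var_ideal_eq)

lemma var_ideal_mono: "C \<subseteq> D \<Longrightarrow> var_ideal X C \<subseteq> var_ideal X D"
  unfolding var_ideal_eq mono_ideal_def by blast

text \<open>Adjoining the variables of \<open>C\<close> one at a time gives a chain of primes of
  length \<open>card C\<close>.\<close>

lemma prime_height_ge:
  fixes X C :: "'v::linorder set"
  assumes C: "finite C" and Q: "primeideal (Q :: ('v, 'k::field) mpoly set) (mpoly_ring X)"
    and sub: "var_ideal X C \<subseteq> Q" and "C \<subseteq> X"
  shows "enat (card C) \<le> prime_height (mpoly_ring X) Q"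
proof -
  obtain h where h: "bij_betw h {..<card C} C"
    using ex_bij_betw_nat_finite[OF C] by (auto simp: atLeast0LessThan)
  \<comment> \<open>The last ideal is replaced by \<open>Q\<close>, where the chain has to end; the
    last inclusion stays strict because \<open>Q\<close> contains the ideal of
    \<open>C\<close>.\<close>
  define P where "P i = (if i = card C then Q else var_ideal X (h ` {..<i}))" for i
  have step: "var_ideal X (h ` {..<i}) \<subset> (var_ideal X (h ` {..<Suc i}) :: ('v, 'k) mpoly set)" if "i < card C" for i
  proof -
    have "h i \<in> X" using that h \<open>C \<subseteq> X\<close> by (auto simp: bij_betw_def)
    moreover have "h i \<notin> h ` {..<i}"
    proof
      assume "h i \<in> h ` {..<i}"
      then obtain x where x: "x < i" "h i = h x" by auto
      then have "i = x"
        using that h inj_onD[of h "{..<card C}" i x] by (auto simp: bij_betw_def)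
      then show False using x by simp
    qed
    ultimately have "var (h i) \<in> (var_ideal X (h ` {..<Suc i}) :: ('v, 'k) mpoly set)"
      "var (h i) \<notin> (var_ideal X (h ` {..<i}) :: ('v, 'k) mpoly set)"
      by (auto simp: var_in_var_ideal)
    moreover have "var_ideal X (h ` {..<i}) \<subseteq> (var_ideal X (h ` {..<Suc i}) :: ('v, 'k) mpoly set)"
      by (rule var_ideal_mono) auto
    ultimately show ?thesis by blast
  qed
  have "primeideal (P i) (mpoly_ring X)" for i
    by (simp add: P_def Q primeideal_var_ideal)
  moreover have "P i \<subset> P (Suc i)" if "i < card C" for i
  proof (cases "Suc i = card C")
    case True
    then have "h ` {..<Suc i} = C" using h by (simp add: bij_betw_def)
    then show ?thesis using step[OF that] sub True by (auto simp: P_def)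
  qed (use step[OF that] that in \<open>simp add: P_def\<close>)
  moreover have "P (card C) = Q" by (simp add: P_def)
  ultimately show ?thesis
    unfolding prime_height_def by (intro Sup_upper) blast
qed

lemma mvmon_add: "mvmon (a + b) = mvmon a * mvmon b"
  by (simp add: mvmon_def mult_single)

lemma primeideal_mvmon_ind_exp:
  fixes Q :: "('v, 'k::field) mpoly set"
  assumes Q: "primeideal Q (mpoly_ring X)" and "finite A" "A \<subseteq> X" "mvmon (ind_exp A) \<in> Q"
  shows "\<exists>v\<in>A. var v \<in> Q"
  using assms(2-4)
proof (induction A rule: finite_induct)
  interpret primeideal Q "mpoly_ring X" by (rule Q)
  {
    case empty
    then have "1 \<in> Q" by (simp add: ind_exp_def mvmon_def)
    then show ?case using one_imp_carrier I_notcarr by simp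
  next
    case (insert v A)
    have "mvmon (ind_exp (insert v A)) = var v * (mvmon (ind_exp A) :: ('v, 'k) mpoly)"
      using insert by (simp add: ind_exp_def mvmon_add var_def)
    moreover have "var v \<in> carrier (mpoly_ring X :: ('v, 'k) mpoly ring)"
      "mvmon (ind_exp A) \<in> carrier (mpoly_ring X :: ('v, 'k) mpoly ring)"
      using insert by (auto simp: var_def mvmon_def carrier_mpoly_ring)
    ultimately have "var v \<in> Q \<or> mvmon (ind_exp A) \<in> Q"
      using I_prime insert by auto
    then show ?case using insert by auto
  }
qed

text \<open>A prime containing the edge ideal contains a variable of every edge, hence the ideal of
  a vertex cover, and the ideal of a cover has the size of the cover as its height.\<close>

lemma alpha0_edge_ideal:
  fixes X C :: "'v::linorder set"
  assumes X: "finite X" "F \<subseteq> Pow X"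
    and C: "C \<subseteq> X" "\<And>A. A \<in> F \<Longrightarrow> A \<inter> C \<noteq> {}"
    and min: "\<And>D. D \<subseteq> X \<Longrightarrow> (\<And>A. A \<in> F \<Longrightarrow> A \<inter> D \<noteq> {}) \<Longrightarrow> card C \<le> card D"
  shows "alpha0 X (edge_ideal X F :: ('v, 'k::field) mpoly set) = enat (card C)"
  unfolding alpha0_def ideal_height_def
proof (rule antisym)
  let ?I = "edge_ideal X F :: ('v, 'k) mpoly set"
  have "?I \<subseteq> var_ideal X C"
    using C(2) by (fastforce simp: edge_ideal_def var_ideal_eq mono_ideal_def)
  then show "Inf {prime_height (mpoly_ring X) P |P. primeideal P (mpoly_ring X) \<and> ?I \<subseteq> P} \<le> enat (card C)"
    using primeideal_var_ideal by (intro Inf_lower2[OF _ prime_height_var_ideal_le[OF X(1) C(1)]]) blast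
  show "enat (card C) \<le> Inf {prime_height (mpoly_ring X) P |P. primeideal P (mpoly_ring X) \<and> ?I \<subseteq> P}"
  proof (rule Inf_greatest, clarify)
    fix Q :: "('v, 'k) mpoly set"
    assume Q: "primeideal Q (mpoly_ring X)" and IQ: "?I \<subseteq> Q"
    define D where "D = {v \<in> X. var v \<in> Q}"
    have QI: "ideal Q (mpoly_ring X)" using Q by (rule primeideal.axioms(1))
    have "A \<inter> D \<noteq> {}" if A: "A \<in> F" for A
    proof -
      have AX: "A \<subseteq> X" using X(2) A by blast
      then have fin: "finite A" using X(1) finite_subset by blast
      have "mvmon (ind_exp A) \<in> ?I" using A AX fin by (auto simp: edge_ideal_def)
      then show ?thesis
        using primeideal_mvmon_ind_exp[OF Q fin AX] IQ AX unfolding D_def by blast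
    qed
    then have "card C \<le> card D" using min[of D] by (auto simp: D_def)
    moreover have "var_ideal X D \<subseteq> Q"
    proof -
      have "genideal (mpoly_ring X) (mvmon ` ind_exp ` (\<lambda>v. {v}) ` D) = (var_ideal X D :: ('v, 'k) mpoly set)"
        unfolding var_ideal_def by (rule genideal_ind_exp) (use X D_def in auto)
      moreover have "mvmon ` ind_exp ` (\<lambda>v. {v}) ` D \<subseteq> Q"
        by (auto simp: D_def ind_exp_def var_def)
      ultimately show ?thesis
        using ring.genideal_minimal[OF ring_mpoly_ring QI] by metis
    qed
    then have "enat (card D) \<le> prime_height (mpoly_ring X) Q"
      using prime_height_ge[OF _ Q] X(1) by (simp add: D_def)
    ultimately show "enat (card C) \<le> prime_height (mpoly_ring X) Q"
      by (meson enat_ord_simps(1) order_trans)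
  qed
qed

section \<open>Minors and the Koenig property\<close>

definition min_edges :: "'v set set \<Rightarrow> 'v set set" where
  "min_edges F = {A \<in> F. \<forall>B\<in>F. B \<subseteq> A \<longrightarrow> B = A}"

lemma ex_min_edge:
  assumes "finite X" "F \<subseteq> Pow X" "A \<in> F"
  shows "\<exists>B\<in>min_edges F. B \<subseteq> A"
proof -
  have "finite F" using assms(1,2) by (meson finite_Pow_iff finite_subset)
  from finite_has_minimal2[OF this assms(3)] show ?thesis
    unfolding min_edges_def by (auto dest: sym)
qed

text \<open>Edges of \<open>F\<close> may contain one another, so only the inclusion-minimal ones
  give minimal generators. Allowing this redundancy lets minors act on all of \<open>F\<close> at
  once.\<close>

lemma min_gens_edge_ideal:
  assumes X: "finite X" "F \<subseteq> Pow X"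
  shows "min_gens (edge_ideal X F :: ('v, 'k::field) mpoly set) = ind_exp ` min_edges F"
proof -
  let ?I = "edge_ideal X F :: ('v, 'k) mpoly set"
  have fin: "finite A" if "A \<in> F" for A
    using that X by (meson PowD finite_subset subsetD)
  have mem: "mvmon e \<in> ?I \<longleftrightarrow> Poly_Mapping.keys e \<subseteq> X \<and> (\<exists>A\<in>F. A \<subseteq> Poly_Mapping.keys e)" for e
    by (simp add: edge_ideal_def)
  have ind_exp_mem: "mvmon (ind_exp A) \<in> ?I" if "A \<in> F" for A
    using that fin[OF that] X(2) unfolding mem by auto
  show ?thesis
  proof (intro equalityI subsetI)
    fix e assume e: "e \<in> min_gens ?I"
    then obtain A where A: "A \<in> F" "A \<subseteq> Poly_Mapping.keys e"
      unfolding min_gens_def mem by blast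
    have eq: "ind_exp B = e" if "B \<in> F" "B \<subseteq> Poly_Mapping.keys e" for B
      using e ind_exp_mem[OF that(1)] ind_exp_le_iff[OF fin[OF that(1)], of e] that(2)
      unfolding min_gens_def by blast
    have "A \<in> min_edges F"
      unfolding min_edges_def
    proof (intro CollectI conjI ballI impI)
      fix B assume B: "B \<in> F" "B \<subseteq> A"
      then have "ind_exp B = ind_exp A" using eq[of A] eq[of B] A by auto
      then show "B = A" using keys_ind_exp[OF fin[OF B(1)]] keys_ind_exp[OF fin[OF A(1)]] by metis
    qed (rule A(1))
    then show "e \<in> ind_exp ` min_edges F" using eq[OF A] by blast
  next
    fix e assume "e \<in> ind_exp ` min_edges F"
    then obtain A where A: "A \<in> F" "\<And>B. B \<in> F \<Longrightarrow> B \<subseteq> A \<Longrightarrow> B = A" "e = ind_exp A"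
      unfolding min_edges_def by blast
    show "e \<in> min_gens ?I"
      unfolding min_gens_def
    proof (intro CollectI conjI allI impI)
      show "mvmon e \<in> ?I" unfolding A(3) by (rule ind_exp_mem[OF A(1)])
      fix e' assume e': "mvmon e' \<in> ?I \<and> (\<forall>v. Poly_Mapping.lookup e' v \<le> Poly_Mapping.lookup e v)"
      then have le: "Poly_Mapping.lookup e' v \<le> of_bool (v \<in> A)" for v
        unfolding A(3) by (simp add: lookup_ind_exp[OF fin[OF A(1)]])
      have "Poly_Mapping.keys e' \<subseteq> A"
      proof
        fix v assume "v \<in> Poly_Mapping.keys e'"
        then show "v \<in> A" using le[of v] by (cases "v \<in> A") (auto simp: in_keys_iff)
      qed
      moreover obtain B where "B \<in> F" "B \<subseteq> Poly_Mapping.keys e'"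
        using e' unfolding mem by blast
      ultimately have "Poly_Mapping.keys e' = A" using A(2)[of B] by blast
      moreover have "Poly_Mapping.lookup e' v \<le> 1" for v
        using le[of v] by (cases "v \<in> A") auto
      ultimately show "e' = e" using ind_exp_keys[of e'] A(3) by simp
    qed
  qed
qed

lemma edge_ideal_cong:
  assumes "\<And>A. A \<in> F \<Longrightarrow> \<exists>B\<in>G. B \<subseteq> A" "\<And>B. B \<in> G \<Longrightarrow> \<exists>A\<in>F. A \<subseteq> B"
  shows "edge_ideal X F = edge_ideal X G"
proof -
  have "(\<exists>A\<in>F. A \<subseteq> K) = (\<exists>A\<in>G. A \<subseteq> K)" for K
    using assms by (meson order_trans)
  then show ?thesis by (simp add: edge_ideal_def)
qed

lemma update_ind_exp:
  "finite A \<Longrightarrow> Poly_Mapping.update x 0 (ind_exp A) = ind_exp (A - {x})"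
  by (rule poly_mapping_eqI) (simp add: lookup_update lookup_ind_exp)

lemma set_var_mvmon_ind_exp:
  assumes "finite A"
  shows "set_var x 0 (mvmon (ind_exp A)) = (if x \<in> A then 0 else mvmon (ind_exp A))"
    and "set_var x 1 (mvmon (ind_exp A)) = mvmon (ind_exp (A - {x}))"
  using assms by (auto simp: set_var_def mvmon_def update_ind_exp lookup_ind_exp)

text \<open>An edge avoiding \<open>x\<close> contains a minimal edge, which avoids \<open>x\<close>
  too; so the minimal edges avoiding \<open>x\<close> generate the same ideal as all edges avoiding
  \<open>x\<close>.\<close>

lemma deletion_edge_ideal:
  assumes X: "finite X" "F \<subseteq> Pow X"
  shows "deletion X x (edge_ideal X F :: ('v, 'k::field) mpoly set) = edge_ideal (X - {x}) {A \<in> F. x \<notin> A}"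
proof -
  have fin: "finite A" if "A \<in> min_edges F" for A
    using that X unfolding min_edges_def by (metis (lifting) PowD finite_subset mem_Collect_eq subsetD)
  have img: "set_var x 0 ` mvmon ` ind_exp ` min_edges F =
      (\<lambda>A. if x \<in> A then 0 else mvmon (ind_exp A) :: ('v, 'k) mpoly) ` min_edges F"
    unfolding image_image by (intro image_cong refl set_var_mvmon_ind_exp(1) fin)
  have "deletion X x (edge_ideal X F :: ('v, 'k) mpoly set) = edge_ideal (X - {x}) {A \<in> min_edges F. x \<notin> A}"
    unfolding deletion_def min_gens_edge_ideal[OF X] img
  proof (rule genideal_ind_exp)
    show "{A \<in> min_edges F. x \<notin> A} \<subseteq> Pow (X - {x})"
      using X(2) unfolding min_edges_def by blast
  qed (use X(1) in auto)
  also have "\<dots> = edge_ideal (X - {x}) {A \<in> F. x \<notin> A}"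
  proof (rule edge_ideal_cong)
    fix A assume "A \<in> {A \<in> F. x \<notin> A}"
    then show "\<exists>B\<in>{A \<in> min_edges F. x \<notin> A}. B \<subseteq> A"
      using ex_min_edge[OF X, of A] by blast
  qed (auto simp: min_edges_def)
  finally show ?thesis .
qed

text \<open>Removing \<open>x\<close> preserves inclusions, so minimal edges and all edges still
  generate the same ideal after the substitution.\<close>

lemma contraction_edge_ideal:
  assumes X: "finite X" "F \<subseteq> Pow X"
  shows "contraction X x (edge_ideal X F :: ('v, 'k::field) mpoly set) = edge_ideal (X - {x}) ((\<lambda>A. A - {x}) ` F)"
proof -
  have fin: "finite A" if "A \<in> min_edges F" for A
    using that X unfolding min_edges_def by (metis (lifting) PowD finite_subset mem_Collect_eq subsetD)
  have img: "set_var x 1 ` mvmon ` ind_exp ` min_edges F =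
      (mvmon ` ind_exp ` (\<lambda>A. A - {x}) ` min_edges F :: ('v, 'k) mpoly set)"
    unfolding image_image by (intro image_cong refl set_var_mvmon_ind_exp(2) fin)
  have "contraction X x (edge_ideal X F :: ('v, 'k) mpoly set) = edge_ideal (X - {x}) ((\<lambda>A. A - {x}) ` min_edges F)"
    unfolding contraction_def min_gens_edge_ideal[OF X] img
  proof (rule genideal_ind_exp)
    show "(\<lambda>A. A - {x}) ` min_edges F \<subseteq> Pow (X - {x})"
      using X(2) unfolding min_edges_def by blast
  qed (use X(1) in auto)
  also have "\<dots> = edge_ideal (X - {x}) ((\<lambda>A. A - {x}) ` F)"
  proof (rule edge_ideal_cong)
    fix A assume "A \<in> (\<lambda>A. A - {x}) ` F"
    then obtain A' where A': "A' \<in> F" "A = A' - {x}" by blast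
    then obtain B where "B \<in> min_edges F" "B \<subseteq> A'" using ex_min_edge[OF X] by blast
    then show "\<exists>B\<in>(\<lambda>A. A - {x}) ` min_edges F. B \<subseteq> A"
      unfolding A'(2) by (intro bexI[of _ "B - {x}"]) auto
  qed (auto simp: min_edges_def)
  finally show ?thesis .
qed

lemma minor_edge_ideal:
  assumes "minor (X, edge_ideal X F :: ('v, 'k::field) mpoly set) (Y, J)" "finite X" "F \<subseteq> Pow X"
  shows "finite Y \<and> (\<exists>G\<subseteq>Pow Y. J = edge_ideal Y G)"
proof -
  let ?P = "\<lambda>YJ :: 'v set \<times> ('v, 'k) mpoly set. finite (fst YJ) \<and> (\<exists>G\<subseteq>Pow (fst YJ). snd YJ = edge_ideal (fst YJ) G)"
  have "minor_step\<^sup>*\<^sup>* (X, edge_ideal X F) (Y, J)" using assms(1) unfolding minor_def .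
  then have "?P (Y, J)"
  proof (induction rule: rtranclp_induct)
    case base
    show ?case using assms(2,3) by auto
  next
    case (step ZK YJ)
    obtain Z K where ZK: "ZK = (Z, K)" by (rule prod.exhaust)
    obtain G where G: "finite Z" "G \<subseteq> Pow Z" "K = edge_ideal Z G" using step.IH unfolding ZK by auto
    consider x where "YJ = (Z - {x}, deletion Z x K)" | x where "YJ = (Z - {x}, contraction Z x K)"
      using step.hyps(2) unfolding ZK minor_step_def by auto
    then show ?case
    proof cases
      case 1
      moreover have "{A \<in> G. x \<notin> A} \<subseteq> Pow (Z - {x})" using G(2) by blast
      ultimately show ?thesis using G(1) deletion_edge_ideal[OF G(1,2), of x] G(3) by auto
    next
      case 2
      moreover have "(\<lambda>A. A - {x}) ` G \<subseteq> Pow (Z - {x})" using G(2) by blast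
      ultimately show ?thesis using G(1) contraction_edge_ideal[OF G(1,2), of x] G(3) by auto
    qed
  qed
  then show ?thesis by simp
qed

section \<open>Disjoint edges, vertex covers and the duality between them\<close>

lemma packs_card_disjoint:
  assumes "finite S" "S \<subseteq> F" "pairwise disjnt S"
  shows "packs F (card S) (\<lambda>_. 1)"
proof -
  obtain As where As: "set As = S" "distinct As" using finite_distinct_list[OF assms(1)] by blast
  have "length (filter (\<lambda>A. v \<in> A) As) \<le> 1" for v
  proof -
    have "length (filter (\<lambda>A. v \<in> A) As) = card {A \<in> S. v \<in> A}"
      using As distinct_card[of "filter (\<lambda>A. v \<in> A) As"] by simp
    also have "\<dots> \<le> Suc 0"
    proof (subst card_le_Suc0_iff_eq)
      show "\<forall>A\<in>{A \<in> S. v \<in> A}. \<forall>B\<in>{A \<in> S. v \<in> A}. A = B"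
        using assms(3) unfolding pairwise_def disjnt_def by blast
    qed (use assms(1) in simp)
    finally show ?thesis by simp
  qed
  then show ?thesis
    unfolding packs_def using As assms(2) by (intro exI[of _ As]) (auto simp: distinct_card)
qed

text \<open>Each edge of the packing is shrunk to a minimal one, and the bound 1 makes the shrunk
  edges disjoint. They are nonempty, hence distinct, so that \<open>card S = t\<close>. The last
  conjunct lets the induction add an edge disjoint from \<open>S\<close>.\<close>

lemma packs_imp_disjoint:
  assumes X: "finite X" "F \<subseteq> Pow X" "{} \<notin> F" and "packs F t a" "\<And>v. a v \<le> 1"
  shows "\<exists>S\<subseteq>min_edges F. finite S \<and> card S = t \<and> pairwise disjnt S \<and> (\<forall>A\<in>S. \<forall>v\<in>A. a v = 1)"
  using assms(4,5)
proof (induction t arbitrary: a)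
  case 0
  show ?case by (rule exI[of _ "{}"]) simp
next
  case (Suc t)
  then obtain A b where A: "A \<in> F" "packs F t b" and le: "\<And>v. b v + of_bool (v \<in> A) \<le> a v"
    unfolding packs_Suc by blast
  have "b v \<le> 1" for v using le[of v] Suc.prems(2)[of v] by simp
  then obtain S where S: "S \<subseteq> min_edges F" "finite S" "card S = t" "pairwise disjnt S"
    "\<And>A v. A \<in> S \<Longrightarrow> v \<in> A \<Longrightarrow> b v = 1"
    using Suc.IH[OF A(2)] by blast
  obtain B where B: "B \<in> min_edges F" "B \<subseteq> A" using ex_min_edge[OF X(1,2) A(1)] by blast
  have "B \<noteq> {}" using B(1) X(3) unfolding min_edges_def by auto
  have B01: "b v = 0 \<and> a v = 1" if "v \<in> B" for v
  proof -
    have "b v + 1 \<le> a v" using le[of v] B(2) that by auto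
    then show ?thesis using Suc.prems(2)[of v] by linarith
  qed
  have disj: "disjnt B D" if "D \<in> S" for D
    using B01 S(5)[OF that] unfolding disjnt_def by fastforce
  then have "B \<notin> S" using \<open>B \<noteq> {}\<close> unfolding disjnt_def by blast
  have "a v = 1" if "D \<in> S" "v \<in> D" for D v
    using S(5)[OF that] le[of v] Suc.prems(2)[of v] by (simp add: le_antisym)
  then show ?case
    using S B B01 disj \<open>B \<notin> S\<close>
    by (intro exI[of _ "insert B S"]) (auto simp: pairwise_insert disjnt_sym)
qed

text \<open>From here on the maximal number of disjoint generators is handled through
  \<open>packs\<close> with all multiplicities 1, which admits arbitrary edges of \<open>F\<close>
  in place of minimal generators.\<close>

lemma le_beta1_edge_ideal:
  assumes X: "finite X" "F \<subseteq> Pow X" "{} \<notin> F"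
  shows "packs F t (\<lambda>_. 1) \<longleftrightarrow> t \<le> beta1 (edge_ideal X F :: ('v, 'k::field) mpoly set)"
proof -
  let ?K = "{card S | S. S \<subseteq> ind_exp ` min_edges F \<and>
     pairwise (\<lambda>e e'. Poly_Mapping.keys e \<inter> Poly_Mapping.keys e' = {}) S}"
  have beta: "beta1 (edge_ideal X F :: ('v, 'k) mpoly set) = Max ?K"
    unfolding beta1_def min_gens_edge_ideal[OF X(1,2)] ..
  have fin: "finite A" if "A \<in> min_edges F" for A
    using that X(1,2) unfolding min_edges_def by (metis (lifting) PowD finite_subset mem_Collect_eq subsetD)
  have "finite F" using X(1,2) by (meson finite_Pow_iff finite_subset)
  then have finm: "finite (min_edges F)" unfolding min_edges_def by simp
  have "?K \<subseteq> card ` Pow (ind_exp ` min_edges F)" by blast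
  then have finK: "finite ?K" using finm finite_subset by blast
  have neK: "?K \<noteq> {}" by (auto intro: exI[of _ "{}"])
  have keys_inv: "Poly_Mapping.keys (ind_exp A) = A" if "A \<in> min_edges F" for A
    using fin that by simp
  show ?thesis
  proof
    assume "packs F t (\<lambda>_. 1)"
    then obtain S where S: "S \<subseteq> min_edges F" "card S = t" "pairwise disjnt S"
      using packs_imp_disjoint[OF X] by (metis order_refl)
    have "inj_on ind_exp S" using S(1) keys_inv by (metis inj_onI subsetD)
    then have "card (ind_exp ` S) = t" using S(2) by (simp add: card_image)
    moreover have "pairwise (\<lambda>e e'. Poly_Mapping.keys e \<inter> Poly_Mapping.keys e' = {}) (ind_exp ` S)"
    proof (rule pairwiseI)
      fix e e' assume "e \<in> ind_exp ` S" "e' \<in> ind_exp ` S" "e \<noteq> e'"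
      then obtain A B where "A \<in> S" "B \<in> S" "A \<noteq> B" "e = ind_exp A" "e' = ind_exp B" by blast
      then show "Poly_Mapping.keys e \<inter> Poly_Mapping.keys e' = {}"
        using S(1,3) keys_inv by (auto simp: pairwise_def disjnt_def subset_iff)
    qed
    ultimately have "t \<in> ?K" using S(1) by blast
    then show "t \<le> beta1 (edge_ideal X F :: ('v, 'k) mpoly set)"
      unfolding beta by (rule Max_ge[OF finK])
  next
    assume t: "t \<le> beta1 (edge_ideal X F :: ('v, 'k) mpoly set)"
    obtain S where S: "S \<subseteq> ind_exp ` min_edges F" "card S = Max ?K"
      "pairwise (\<lambda>e e'. Poly_Mapping.keys e \<inter> Poly_Mapping.keys e' = {}) S"
      using Max_in[OF finK neK] by auto
    let ?T = "Poly_Mapping.keys ` S"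
    have Sm: "\<exists>A\<in>min_edges F. e = ind_exp A \<and> Poly_Mapping.keys e = A" if "e \<in> S" for e
      using subsetD[OF S(1) that] keys_inv by auto
    have ik: "ind_exp (Poly_Mapping.keys e) = e" if "e \<in> S" for e
      using Sm[OF that] by auto
    then have "inj_on Poly_Mapping.keys S" by (rule inj_on_inverseI)
    then have "card ?T = Max ?K" using S(2) by (simp add: card_image)
    moreover have "finite ?T" using S(1) finm by (meson finite_imageI finite_subset)
    moreover have "?T \<subseteq> F"
    proof (rule image_subsetI)
      fix e assume "e \<in> S"
      from Sm[OF this] show "Poly_Mapping.keys e \<in> F" by (auto simp: min_edges_def)
    qed
    moreover have "pairwise disjnt ?T"
      using S(3) by (intro pairwise_imageI) (simp add: pairwise_def disjnt_def)
    ultimately have "packs F (Max ?K) (\<lambda>_. 1)" using packs_card_disjoint[of ?T F] by simp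
    then show "packs F t (\<lambda>_. 1)"
      by (rule packs_mono[OF _ order_refl t[unfolded beta]])
  qed
qed

text \<open>Weak duality: each edge of the packing uses up at least one unit of the weight of
  \<open>a\<close> on \<open>D\<close>.\<close>

lemma packs_le_cover:
  assumes "packs F t a" "finite D" "\<And>A. A \<in> F \<Longrightarrow> A \<inter> D \<noteq> {}"
  shows "t \<le> sum a D"
  using assms(1)
proof (induction t arbitrary: a)
  case (Suc t)
  then obtain A b where A: "A \<in> F" "packs F t b" "\<And>v. b v + of_bool (v \<in> A) \<le> a v"
    unfolding packs_Suc by blast
  obtain w where w: "w \<in> A" "w \<in> D" using assms(3)[OF A(1)] by blast
  have "Suc t \<le> sum b D + 1" using Suc.IH[OF A(2)] by simp
  also have "1 \<le> (\<Sum>v\<in>D. of_bool (v \<in> A) :: nat)"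
    using member_le_sum[of w D "\<lambda>v. of_bool (v \<in> A) :: nat"] w assms(2) by simp
  also have "sum b D + (\<Sum>v\<in>D. of_bool (v \<in> A)) \<le> sum a D"
    unfolding sum.distrib[symmetric] by (rule sum_mono) (rule A(3))
  finally show ?case by simp
qed simp

text \<open>By weak duality a cover and a packing of equal size are both optimal.\<close>

lemma koenig_edge_ideal:
  fixes X C :: "'v::linorder set"
  assumes X: "finite X" "F \<subseteq> Pow X"
    and C: "C \<subseteq> X" "\<And>A. A \<in> F \<Longrightarrow> A \<inter> C \<noteq> {}" and packs: "packs F (card C) (\<lambda>_. 1)"
  shows "koenig X (edge_ideal X F :: ('v, 'k::field) mpoly set)"
proof -
  let ?I = "edge_ideal X F :: ('v, 'k) mpoly set"
  have ne: "{} \<notin> F" using C(2) by blast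
  note le_beta = le_beta1_edge_ideal[OF X ne, where 'k = 'k]
  have "alpha0 X ?I = enat (card C)"
  proof (rule alpha0_edge_ideal[OF X C])
    fix D assume "D \<subseteq> X" "\<And>A. A \<in> F \<Longrightarrow> A \<inter> D \<noteq> {}"
    then show "card C \<le> card D"
      using packs_le_cover[OF packs, of D] X(1) finite_subset[of D X] by simp
  qed
  moreover have "card C \<le> beta1 ?I" using packs unfolding le_beta .
  moreover have "packs F (beta1 ?I) (\<lambda>_. 1)" unfolding le_beta ..
  then have "beta1 ?I \<le> card C"
    using packs_le_cover[of F "beta1 ?I" "\<lambda>_. 1" C] C(2) finite_subset[OF C(1) X(1)] by simp
  ultimately show ?thesis by (simp add: koenig_def)
qed

section \<open>Associated primes of powers\<close>

lemma lookup_mult_mvmon: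
  fixes r :: "('v, 'k::field) mpoly"
  shows "Poly_Mapping.lookup (r * mvmon b) (e + b) = Poly_Mapping.lookup r e"
proof -
  have "r * mvmon b =
      (\<Sum>x\<in>Poly_Mapping.keys r. Poly_Mapping.single (x + b) (Poly_Mapping.lookup r x))"
    by (subst (1) poly_mapping_sum_single[of r]) (simp add: sum_distrib_right mvmon_def mult_single)
  then show ?thesis
    by (simp add: lookup_sum lookup_single when_def in_keys_iff)
qed

text \<open>Multiplication by a monomial shifts exponents injectively, so no terms cancel and the
  colon ideal can be computed on monomials.\<close>

lemma colon_mono_ideal_eq_var_ideal:
  fixes X :: "'v set"
  assumes b: "Poly_Mapping.keys b \<subseteq> X"
    and Q: "\<And>e. Poly_Mapping.keys e \<subseteq> X \<Longrightarrow> Q (e + b) \<longleftrightarrow> Poly_Mapping.keys e \<inter> C \<noteq> {}"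
  shows "{r \<in> carrier (mpoly_ring X). r \<otimes>\<^bsub>mpoly_ring X\<^esub> mvmon b \<in> mono_ideal X Q} =
    (var_ideal X C :: ('v, 'k::field) mpoly set)"
proof (intro equalityI subsetI)
  fix r :: "('v, 'k) mpoly"
  assume "r \<in> {r \<in> carrier (mpoly_ring X). r \<otimes>\<^bsub>mpoly_ring X\<^esub> mvmon b \<in> mono_ideal X Q}"
  then have r: "r \<in> carrier (mpoly_ring X)" "r * mvmon b \<in> mono_ideal X Q" by simp_all
  show "r \<in> var_ideal X C"
    unfolding var_ideal_eq mono_ideal_def
  proof (intro CollectI ballI conjI)
    fix e assume e: "e \<in> Poly_Mapping.keys r"
    then show eX: "Poly_Mapping.keys e \<subseteq> X" using r(1) by (auto simp: carrier_mpoly_ring)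
    have "e + b \<in> Poly_Mapping.keys (r * mvmon b)"
      using e by (simp add: in_keys_iff lookup_mult_mvmon)
    then have "Q (e + b)" using r(2) by (simp add: mono_ideal_def)
    then show "Poly_Mapping.keys e \<inter> C \<noteq> {}" using Q[OF eX] by blast
  qed
next
  fix r :: "('v, 'k) mpoly"
  assume r: "r \<in> var_ideal X C"
  then have "r \<in> carrier (mpoly_ring X)" using ideal_mpoly_ring_sub[OF ideal_var_ideal] by blast
  moreover have "r * mvmon b \<in> mono_ideal X Q"
  proof (rule mono_ideal_mult[OF _ r[unfolded var_ideal_eq], where Q' = "\<lambda>e. e = b"])
    show "mvmon b \<in> mono_ideal X (\<lambda>e. e = b)" using b by simp
  qed (use Q in blast)
  ultimately show "r \<in> {r \<in> carrier (mpoly_ring X). r \<otimes>\<^bsub>mpoly_ring X\<^esub> mvmon b \<in> mono_ideal X Q}"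
    by simp
qed

lemma var_ideal_in_Ass:
  fixes X C :: "'v::linorder set"
  assumes b: "Poly_Mapping.keys b \<subseteq> X"
    and Q: "\<And>e. Poly_Mapping.keys e \<subseteq> X \<Longrightarrow> Q (e + b) \<longleftrightarrow> Poly_Mapping.keys e \<inter> C \<noteq> {}"
  shows "(var_ideal X C :: ('v, 'k::field) mpoly set) \<in> Ass (mpoly_ring X) (mono_ideal X Q)"
  unfolding Ass_def
proof (intro CollectI conjI bexI)
  show "primeideal (var_ideal X C :: ('v, 'k) mpoly set) (mpoly_ring X)" by (rule primeideal_var_ideal)
  show "var_ideal X C = {r \<in> carrier (mpoly_ring X). r \<otimes>\<^bsub>mpoly_ring X\<^esub> mvmon b \<in> mono_ideal X Q}"
    by (rule colon_mono_ideal_eq_var_ideal[OF b Q, symmetric])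
  show "mvmon b \<in> carrier (mpoly_ring X)" using b by (simp add: carrier_eq_mono_ideal)
qed

text \<open>Some term \<open>e\<close> of the element \<open>f\<close> lies outside
  \<open>Q\<close>, and every variable of \<open>C\<close> moves it into \<open>Q\<close>. Both
  witnesses are recorded: \<open>f\<close> shows that \<open>C\<close> is a cover, \<open>e\<close>
  that it is minimal.\<close>

lemma Ass_witness:
  fixes X :: "'v set"
  assumes "(var_ideal X C :: ('v, 'k::field) mpoly set) \<in> Ass (mpoly_ring X) (mono_ideal X Q)"
  shows "\<exists>f e. f \<in> carrier (mpoly_ring X) \<and>
    (\<forall>r\<in>carrier (mpoly_ring X). r \<in> (var_ideal X C :: ('v, 'k) mpoly set) \<longleftrightarrow> r * f \<in> mono_ideal X Q) \<and>
    Poly_Mapping.keys e \<subseteq> X \<and> \<not> Q e \<and> (\<forall>v\<in>C \<inter> X. Q (e + Poly_Mapping.single v 1))"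
proof -
  obtain f :: "('v, 'k) mpoly" where f: "f \<in> carrier (mpoly_ring X)"
    "\<And>r. r \<in> carrier (mpoly_ring X) \<Longrightarrow> r \<in> (var_ideal X C :: ('v, 'k) mpoly set) \<longleftrightarrow> r * f \<in> mono_ideal X Q"
    using assms unfolding Ass_def by auto
  have "(1 :: ('v, 'k) mpoly) \<notin> var_ideal X C" by (simp add: var_ideal_eq mono_ideal_def)
  then have "f \<notin> mono_ideal X Q" using f(2)[of 1] by (simp add: carrier_mpoly_ring)
  then obtain e where e: "e \<in> Poly_Mapping.keys f" "\<not> Q e" "Poly_Mapping.keys e \<subseteq> X"
    using f(1) by (auto simp: mono_ideal_def carrier_mpoly_ring)
  have step: "Q (e + Poly_Mapping.single v 1)" if "v \<in> C" "v \<in> X" for v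
  proof -
    have "(var v :: ('v, 'k) mpoly) \<in> var_ideal X C" using that by (simp add: var_in_var_ideal)
    then have "f * var v \<in> mono_ideal X Q"
      using f(2)[of "var v"] that(2) by (simp add: mult.commute carrier_mpoly_ring var_def mvmon_def)
    moreover have "e + Poly_Mapping.single v 1 \<in> Poly_Mapping.keys (f * var v)"
      using e(1) by (simp add: in_keys_iff var_def lookup_mult_mvmon)
    ultimately show ?thesis by (simp add: mono_ideal_def)
  qed
  show ?thesis using f e(2,3) step by blast
qed

text \<open>The conclusions say that \<open>C\<close> is a minimal vertex cover. The edge ideal lies
  in the colon ideal, which is the prime of \<open>C\<close>; and multiplying the witness monomial
  by the variable \<open>i\<close> completes an edge whose only vertex in \<open>C\<close> is
  \<open>i\<close>.\<close>

lemma var_ideal_in_Ass_edge_ideal: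
  fixes X :: "'v set"
  assumes X: "finite X" "F \<subseteq> Pow X" "C \<subseteq> X"
    and Ass: "(var_ideal X C :: ('v, 'k::field) mpoly set) \<in> Ass (mpoly_ring X) (edge_ideal X F)"
  shows "\<And>A. A \<in> F \<Longrightarrow> A \<inter> C \<noteq> {}" and "\<And>i. i \<in> C \<Longrightarrow> \<exists>A\<in>F. A \<inter> C = {i}"
proof -
  obtain f :: "('v, 'k) mpoly" and e :: "'v \<Rightarrow>\<^sub>0 nat" where f: "f \<in> carrier (mpoly_ring X)"
    "\<forall>r\<in>carrier (mpoly_ring X). r \<in> (var_ideal X C :: ('v, 'k) mpoly set) \<longleftrightarrow> r * f \<in> edge_ideal X F"
    and e: "\<not> (\<exists>A\<in>F. A \<subseteq> Poly_Mapping.keys e)"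
    "\<forall>v\<in>C \<inter> X. \<exists>A\<in>F. A \<subseteq> Poly_Mapping.keys (e + Poly_Mapping.single v 1)"
    using Ass_witness[OF Ass[unfolded edge_ideal_def], folded edge_ideal_def] by blast
  show "A \<inter> C \<noteq> {}" if A: "A \<in> F" for A
  proof -
    have fin: "finite A" using A X by (meson PowD finite_subset subsetD)
    have AX: "A \<subseteq> X" using A X by blast
    have "(mvmon (ind_exp A) :: ('v, 'k) mpoly) \<in> edge_ideal X F"
      using A AX fin by (auto simp: edge_ideal_def)
    from ideal_mpoly_ring_mult[OF ideal_edge_ideal this f(1)]
    have "mvmon (ind_exp A) * f \<in> edge_ideal X F" by (simp add: mult.commute)
    moreover have "(mvmon (ind_exp A) :: ('v, 'k) mpoly) \<in> carrier (mpoly_ring X)"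
      using AX fin by (simp add: carrier_eq_mono_ideal)
    ultimately have "(mvmon (ind_exp A) :: ('v, 'k) mpoly) \<in> var_ideal X C" using f(2) by blast
    then show ?thesis using fin by (simp add: var_ideal_eq)
  qed
  have edge: "\<exists>A\<in>F. i \<in> A \<and> A \<subseteq> insert i (Poly_Mapping.keys e)" if "i \<in> C" for i
  proof -
    have "i \<in> C \<inter> X" using X(3) that by blast
    from bspec[OF e(2) this] obtain A where A: "A \<in> F" "A \<subseteq> insert i (Poly_Mapping.keys e)"
      by (auto simp: keys_add_nat)
    moreover have "i \<in> A" using A e(1) by (metis subset_insert)
    ultimately show ?thesis by blast
  qed
  \<comment> \<open>For \<open>i\<close> in the support of \<open>e\<close> a further factor would
    not change the support, so the support of \<open>e\<close> would already contain an
    edge.\<close>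
  have disj: "i \<notin> Poly_Mapping.keys e" if i: "i \<in> C" for i
  proof
    assume "i \<in> Poly_Mapping.keys e"
    then have "insert i (Poly_Mapping.keys e) = Poly_Mapping.keys e" by blast
    then show False using edge[OF i] e(1) by metis
  qed
  show "\<exists>A\<in>F. A \<inter> C = {i}" if i: "i \<in> C" for i
  proof -
    obtain A where A: "A \<in> F" "i \<in> A" "A \<subseteq> insert i (Poly_Mapping.keys e)" using edge[OF i] by blast
    then have "A \<inter> C = {i}" using disj i by auto
    then show ?thesis using A(1) by blast
  qed
qed

text \<open>A multiple \<open>x\<^sup>b\<close> of \<open>x\<^sup>a\<close> for which the set of variables annihilating it is largest has an
  annihilator generated by that set.\<close>

lemma ex_prime_colon:
  fixes X :: "'v set" and Q :: "('v \<Rightarrow>\<^sub>0 nat) \<Rightarrow> bool"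
  assumes X: "finite X" and a: "Poly_Mapping.keys a \<subseteq> X" "\<not> Q a"
    and mono: "\<And>e f. Q e \<Longrightarrow> Q (e + f)"
  shows "\<exists>f C. C \<subseteq> X \<and> Poly_Mapping.keys f \<subseteq> X \<and>
    (\<forall>e. Poly_Mapping.keys e \<subseteq> X \<longrightarrow> (Q (e + (a + f)) \<longleftrightarrow> Poly_Mapping.keys e \<inter> C \<noteq> {}))"
proof -
  define K where "K b = {v \<in> X. Q (b + Poly_Mapping.single v 1)}" for b
  define P where "P f \<longleftrightarrow> Poly_Mapping.keys f \<subseteq> X \<and> \<not> Q (a + f)" for f
  have finK: "finite (K b)" for b using X by (simp add: K_def)
  have "P 0" using a(2) by (simp add: P_def)
  moreover have "\<forall>f. P f \<longrightarrow> card (K (a + f)) < Suc (card X)"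
    using X by (auto simp: K_def less_Suc_eq_le intro!: card_mono)
  ultimately obtain f where f: "P f" "\<And>g. P g \<Longrightarrow> card (K (a + g)) \<le> card (K (a + f))"
    using ex_has_greatest_nat[of P 0 "\<lambda>f. card (K (a + f))" "Suc (card X)"] by blast
  define b where "b = a + f"
  \<comment> \<open>Induction on the degree of \<open>e\<close>: strip off a variable
    \<open>v\<close>. The exponent \<open>e' + b\<close> is outside \<open>Q\<close>, and its set of
    annihilating variables contains \<open>K b\<close>, hence equals it by maximality; so
    multiplying by \<open>v\<close> again stays outside \<open>Q\<close>.\<close>
  have notQ: "\<not> Q (e + b)" if "Poly_Mapping.keys e \<subseteq> X" "Poly_Mapping.keys e \<inter> K b = {}" for e
    using that
  proof (induction "sum (Poly_Mapping.lookup e) X" arbitrary: e rule: less_induct)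
    case less
    show ?case
    proof (cases "e = 0")
      case True
      then show ?thesis using f(1) by (simp add: P_def b_def)
    next
      case False
      then have "Poly_Mapping.keys e \<noteq> {}" by simp
      then obtain v where v: "v \<in> Poly_Mapping.keys e" by blast
      define e' where "e' = e - Poly_Mapping.single v 1"
      have l: "Poly_Mapping.lookup e' w = Poly_Mapping.lookup e w - (if w = v then 1 else 0)" for w
        by (simp add: e'_def lookup_minus lookup_single when_def)
      have eq: "e = e' + Poly_Mapping.single v 1"
        using v by (intro poly_mapping_eqI) (auto simp: lookup_add l lookup_single when_def in_keys_iff)
      have sub: "Poly_Mapping.keys e' \<subseteq> Poly_Mapping.keys e"
        by (auto simp: in_keys_iff l split: if_splits)
      have vX: "v \<in> X" "v \<notin> K b" using v less.prems by auto
      have "sum (Poly_Mapping.lookup e') X < sum (Poly_Mapping.lookup e) X"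
        using v vX X by (intro sum_strict_mono_ex1) (auto simp: l in_keys_iff intro!: bexI[of _ v])
      then have nQ: "\<not> Q (e' + b)" using less sub by blast
      have "P (f + e')"
        using nQ f(1) sub less.prems(1) by (auto simp: P_def b_def keys_add_nat algebra_simps)
      then have "card (K (e' + b)) \<le> card (K b)"
        using f(2)[of "f + e'"] by (simp add: b_def algebra_simps)
      moreover have "K b \<subseteq> K (e' + b)"
      proof
        fix w assume "w \<in> K b"
        then have "w \<in> X" "Q ((b + Poly_Mapping.single w 1) + e')" using mono by (auto simp: K_def)
        then show "w \<in> K (e' + b)" by (simp add: K_def algebra_simps)
      qed
      ultimately have "K b = K (e' + b)" using finK card_seteq by blast
      then have "v \<notin> K (e' + b)" using vX(2) by simp
      then show ?thesis using vX(1) by (subst eq) (simp add: K_def algebra_simps)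
    qed
  qed
  have "Q (e + b) \<longleftrightarrow> Poly_Mapping.keys e \<inter> K b \<noteq> {}" if eX: "Poly_Mapping.keys e \<subseteq> X" for e
  proof
    show "Poly_Mapping.keys e \<inter> K b \<noteq> {}" if "Q (e + b)" using notQ[OF eX] that by blast
    assume "Poly_Mapping.keys e \<inter> K b \<noteq> {}"
    then obtain v where v: "v \<in> Poly_Mapping.keys e" "v \<in> K b" by blast
    have "e + b = (b + Poly_Mapping.single v 1) + (e - Poly_Mapping.single v 1)"
      using v(1) by (intro poly_mapping_eqI)
        (auto simp: lookup_add lookup_minus lookup_single when_def in_keys_iff)
    moreover have "Q (b + Poly_Mapping.single v 1)" using v(2) by (simp add: K_def)
    ultimately show "Q (e + b)" using mono by metis
  qed
  moreover have "K b \<subseteq> X" by (auto simp: K_def)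
  ultimately show ?thesis
    using f(1) unfolding P_def b_def[symmetric] by (intro exI[of _ f] exI[of _ "K b"]) (simp add: b_def)
qed

section \<open>Monomials in powers of normally torsion-free edge ideals\<close>

lemma packs_add: "packs F t (Poly_Mapping.lookup e) \<Longrightarrow> packs F t (Poly_Mapping.lookup (e + f))"
  by (erule packs_mono) (simp_all add: lookup_add)

text \<open>Localization at the prime of \<open>C\<close> in combinatorial form: each unit of
  \<open>b\<close> on a vertex of \<open>C\<close> pays for an edge meeting \<open>C\<close> only
  there, and multiplicity \<open>t\<close> on the other vertices leaves room for all
  \<open>t\<close> edges.\<close>

lemma packs_of_private_edges:
  assumes "finite C" "C \<subseteq> X" "F \<subseteq> Pow X"
    and edges: "\<And>i. i \<in> C \<Longrightarrow> \<exists>A\<in>F. A \<inter> C = {i}"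
    and "t \<le> sum b C"
  shows "packs F t (\<lambda>v. if v \<in> C then b v else if v \<in> X then t else 0)"
  using assms(5)
proof (induction t arbitrary: b)
  case (Suc t)
  then have "sum b C \<noteq> 0" by simp
  then obtain i where i: "i \<in> C" "b i \<noteq> 0" by (meson sum.neutral)
  define b' where "b' = b(i := b i - 1)"
  obtain A where A: "A \<in> F" "A \<inter> C = {i}" using edges[OF i(1)] by blast
  have "sum b C = b i + sum b (C - {i})" "sum b' C = (b i - 1) + sum b (C - {i})"
    using assms(1) i(1) by (simp_all add: sum.remove b'_def)
  then have "t \<le> sum b' C" using Suc.prems i(2) by simp
  note IH = Suc.IH[OF this]
  have "(if v \<in> C then b' v else if v \<in> X then t else 0) + of_bool (v \<in> A)
      \<le> (if v \<in> C then b v else if v \<in> X then Suc t else 0)" for v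
  proof (cases "v \<in> C")
    case True
    then have "v \<in> A \<longleftrightarrow> v = i" using A(2) by blast
    then show ?thesis using True i by (auto simp: b'_def)
  next
    case False
    have "v \<in> A \<Longrightarrow> v \<in> X" using A(1) assms(3) by blast
    then show ?thesis using False by auto
  qed
  then show ?case unfolding packs_Suc using A(1) IH by blast
qed simp

text \<open>The equality of symbolic and ordinary powers, read off monomial by monomial: \<open>x\<^sup>a\<close> lies in
  the \<open>t\<close>-th symbolic power iff every vertex cover has degree at least \<open>t\<close> in \<open>a\<close>.\<close>

lemma normally_torsion_free_packs:
  fixes X :: "'v::linorder set"
  assumes X: "finite X" "F \<subseteq> Pow X"
    and ntf: "normally_torsion_free (mpoly_ring X) (edge_ideal X F :: ('v, 'k::field) mpoly set)"
    and a: "Poly_Mapping.keys a \<subseteq> X"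
    and cover: "\<And>C. C \<subseteq> X \<Longrightarrow> (\<And>A. A \<in> F \<Longrightarrow> A \<inter> C \<noteq> {}) \<Longrightarrow> t \<le> sum (Poly_Mapping.lookup a) C"
  shows "packs F t (Poly_Mapping.lookup a)"
proof (rule ccontr)
  let ?I = "edge_ideal X F :: ('v, 'k) mpoly set"
  let ?Q = "\<lambda>e. packs F t (Poly_Mapping.lookup e)"
  assume not: "\<not> packs F t (Poly_Mapping.lookup a)"
  then have "t \<ge> 1" by (cases t) auto
  obtain f C where C: "C \<subseteq> X" and f: "Poly_Mapping.keys f \<subseteq> X" and
    Q: "\<forall>e. Poly_Mapping.keys e \<subseteq> X \<longrightarrow> (?Q (e + (a + f)) \<longleftrightarrow> Poly_Mapping.keys e \<inter> C \<noteq> {})"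
    using ex_prime_colon[where Q = ?Q, OF X(1) a not packs_add] by blast
  define b where "b = a + f"
  have b: "Poly_Mapping.keys b \<subseteq> X" using a f by (simp add: b_def keys_add_nat)
  have "var_ideal X C \<in> Ass (mpoly_ring X) (ideal_pow (mpoly_ring X) ?I t)"
    unfolding ideal_pow_edge_ideal[OF X] by (rule var_ideal_in_Ass[OF b]) (use Q in \<open>simp add: b_def\<close>)
  \<comment> \<open>Normal torsion-freeness enters here: the prime is associated to the edge ideal
    itself, so \<open>C\<close> is a minimal vertex cover.\<close>
  then have Ass: "var_ideal X C \<in> Ass (mpoly_ring X) ?I"
    using ntf \<open>t \<ge> 1\<close> unfolding normally_torsion_free_def by blast
  note edges = var_ideal_in_Ass_edge_ideal[OF X C Ass]
  have finC: "finite C" using C X(1) by (rule finite_subset)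
  have "t \<le> sum (Poly_Mapping.lookup a) C" using cover[OF C edges(1)] .
  also have "\<dots> \<le> sum (Poly_Mapping.lookup b) C"
    by (rule sum_mono) (simp add: b_def lookup_add)
  finally have tb: "t \<le> sum (Poly_Mapping.lookup b) C" .
  \<comment> \<open>The \<open>t\<close>-th powers of the variables outside \<open>C\<close> make
    room for the private edges and bring \<open>x^b\<close> into the power, although no monomial in
    those variables annihilates it.\<close>
  define e where "e = (\<Sum>v\<in>X - C. Poly_Mapping.single v t)"
  have le: "Poly_Mapping.lookup e v = (if v \<in> X - C then t else 0)" for v
    using X(1) by (simp add: e_def lookup_sum lookup_single when_def)
  then have ke: "Poly_Mapping.keys e \<subseteq> X - C" by (auto simp: in_keys_iff split: if_splits)
  have "?Q (e + b)"
    using packs_of_private_edges[OF finC C X(2) edges(2) tb]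
    by (rule packs_mono) (simp_all add: lookup_add le)
  moreover have "\<not> ?Q (e + b)" using spec[OF Q, of e] ke unfolding b_def by blast
  ultimately show False by simp
qed

section \<open>The product of all variables and the Koenig property\<close>

lemma packs_ind_exp:
  assumes "finite X" "F \<subseteq> Pow X" "packs F t (\<lambda>_. 1)"
  shows "packs F t (Poly_Mapping.lookup (ind_exp X))"
proof -
  obtain As where As: "length As = t" "set As \<subseteq> F" "\<And>v. length (filter (\<lambda>A. v \<in> A) As) \<le> 1"
    using assms(3) unfolding packs_def by blast
  have "length (filter (\<lambda>A. v \<in> A) As) \<le> Poly_Mapping.lookup (ind_exp X) v" for v
  proof (cases "v \<in> X")
    case False
    then have "filter (\<lambda>A. v \<in> A) As = []"
      using As(2) assms(2) by (auto simp: filter_empty_conv)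
    then show ?thesis by simp
  qed (use As(3) assms(1) in \<open>simp add: lookup_ind_exp\<close>)
  then show ?thesis unfolding packs_def using As by blast
qed

lemma packs_lookup_ind_exp_imp:
  "finite X \<Longrightarrow> packs F t (Poly_Mapping.lookup (ind_exp X)) \<Longrightarrow> packs F t (\<lambda>_. 1)"
  by (erule packs_mono) (simp_all add: lookup_ind_exp)

lemma sum_lookup_ind_exp: "finite X \<Longrightarrow> C \<subseteq> X \<Longrightarrow> sum (Poly_Mapping.lookup (ind_exp X)) C = card C"
  by (simp add: lookup_ind_exp subset_iff of_bool_def)

text \<open>Applied to the product of all variables with \<open>t\<close> the least size of a cover,
  the criterion yields as many disjoint edges as that cover has elements.\<close>

lemma normally_torsion_free_koenig:
  fixes X :: "'v::linorder set"
  assumes X: "finite X" "F \<subseteq> Pow X"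
    and ntf: "normally_torsion_free (mpoly_ring X) (edge_ideal X F :: ('v, 'k::field) mpoly set)"
  shows "koenig X (edge_ideal X F :: ('v, 'k) mpoly set)"
proof (cases "{} \<in> F")
  case True
  then have "(edge_ideal X F :: ('v, 'k) mpoly set) = carrier (mpoly_ring X)"
    by (auto simp: edge_ideal_def mono_ideal_def carrier_mpoly_ring)
  then show ?thesis by (simp add: koenig_def)
next
  case False
  define cover where "cover C \<longleftrightarrow> C \<subseteq> X \<and> (\<forall>A\<in>F. A \<inter> C \<noteq> {})" for C
  have "cover X" using False X(2) by (auto simp: cover_def) (metis Int_absorb2 PowD subsetD)
  then obtain C where C: "cover C" "\<And>D. cover D \<Longrightarrow> card C \<le> card D"
    using ex_has_least_nat[of cover X card] by blast
  have "packs F (card C) (Poly_Mapping.lookup (ind_exp X))"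
  proof (rule normally_torsion_free_packs[OF X ntf])
    fix D assume "D \<subseteq> X" "\<And>A. A \<in> F \<Longrightarrow> A \<inter> D \<noteq> {}"
    then show "card C \<le> sum (Poly_Mapping.lookup (ind_exp X)) D"
      using C(2)[of D] X(1) by (simp add: cover_def sum_lookup_ind_exp)
  qed (use X(1) in simp)
  then have "packs F (card C) (\<lambda>_. 1)" by (rule packs_lookup_ind_exp_imp[OF X(1)])
  then show ?thesis using C(1) by (intro koenig_edge_ideal[OF X, of C]) (auto simp: cover_def)
qed

section \<open>The maximal ideal as an associated prime of powers\<close>

lemma packs_contraction:
  assumes "packs ((\<lambda>A. A - {v}) ` F) t a"
  shows "packs F t (\<lambda>w. if w = v then a v + t else a w)"
  using assms
proof (induction t arbitrary: a)
  case (Suc t)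
  then obtain A b where A: "A \<in> F" "packs ((\<lambda>A. A - {v}) ` F) t b"
    "\<And>w. b w + of_bool (w \<in> A - {v}) \<le> a w"
    unfolding packs_Suc by blast
  \<comment> \<open>Lifting an edge back to \<open>F\<close> may add the vertex \<open>v\<close>
    once, and the additional unit on \<open>v\<close> pays for it.\<close>
  have "(if w = v then b v + t else b w) + of_bool (w \<in> A) \<le> (if w = v then a v + Suc t else a w)" for w
    using A(3)[of w] by (cases "w \<in> A") auto
  then show ?case unfolding packs_Suc using A(1) Suc.IH[OF A(2)] by blast
qed simp

lemma packs_deletion:
  assumes "packs F t a" "a v = 0"
  shows "packs {A \<in> F. v \<notin> A} t a"
proof -
  obtain As where As: "length As = t" "set As \<subseteq> F" "\<forall>w. length (filter (\<lambda>A. w \<in> A) As) \<le> a w"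
    using assms(1) unfolding packs_def by blast
  have "filter (\<lambda>A. v \<in> A) As = []" using As(3) assms(2) by (metis le_zero_eq length_0_conv)
  then have "set As \<subseteq> {A \<in> F. v \<notin> A}" using As(2) by (auto simp: filter_empty_conv)
  then show ?thesis unfolding packs_def using As by blast
qed

lemma packs_subset: "packs F t a \<Longrightarrow> F \<subseteq> G \<Longrightarrow> packs G t a"
  unfolding packs_def by blast

lemma genideal_var:
  "finite X \<Longrightarrow> genideal (mpoly_ring X) (var ` X) = (var_ideal X X :: ('v, 'k::field) mpoly set)"
proof -
  assume X: "finite X"
  have "ind_exp {v} = Poly_Mapping.single v 1" for v :: 'v by (simp add: ind_exp_def)
  then have "mvmon ` ind_exp ` (\<lambda>v. {v}) ` X = (var ` X :: ('v, 'k) mpoly set)"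
    by (simp add: image_image var_def)
  then show ?thesis
    unfolding var_ideal_def using X by (intro genideal_ind_exp) auto
qed

text \<open>Some multiple of the product of all variables has a prime colon ideal, generated by a
  set \<open>C\<close> of variables. The contraction of \<open>v\<close> shows that the
  \<open>t\<close>-th power of the variable \<open>v\<close> moves this multiple into the ideal
  power, which forces \<open>v\<close> into \<open>C\<close>.\<close>

lemma max_ideal_in_Ass:
  fixes X :: "'v::linorder set"
  assumes X: "finite X" "F \<subseteq> Pow X"
    and ntf: "\<And>v. v \<in> X \<Longrightarrow> normally_torsion_free (mpoly_ring (X - {v}))
      (edge_ideal (X - {v}) ((\<lambda>A. A - {v}) ` F) :: ('v, 'k::field) mpoly set)"
    and cover: "\<And>C. C \<subseteq> X \<Longrightarrow> (\<And>A. A \<in> F \<Longrightarrow> A \<inter> C \<noteq> {}) \<Longrightarrow> t \<le> card C"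
    and not_packs: "\<not> packs F t (\<lambda>_. 1)"
  shows "var_ideal X X \<in> Ass (mpoly_ring X) (ideal_pow (mpoly_ring X) (edge_ideal X F :: ('v, 'k) mpoly set) t)"
proof -
  let ?Q = "\<lambda>e. packs F t (Poly_Mapping.lookup e)"
  have a: "Poly_Mapping.keys (ind_exp X) \<subseteq> X" using X(1) by simp
  have not: "\<not> ?Q (ind_exp X)" using packs_lookup_ind_exp_imp[OF X(1)] not_packs by blast
  obtain f C where C: "C \<subseteq> X" and f: "Poly_Mapping.keys f \<subseteq> X" and
    Q: "\<forall>e. Poly_Mapping.keys e \<subseteq> X \<longrightarrow> (?Q (e + (ind_exp X + f)) \<longleftrightarrow> Poly_Mapping.keys e \<inter> C \<noteq> {})"
    using ex_prime_colon[where Q = ?Q, OF X(1) a not packs_add] by blast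
  have "v \<in> C" if v: "v \<in> X" for v
  proof (rule ccontr)
    assume vC: "v \<notin> C"
    let ?Y = "X - {v}" and ?G = "(\<lambda>A. A - {v}) ` F"
    have Y: "finite ?Y" "?G \<subseteq> Pow ?Y" using X by auto
    have "packs ?G t (Poly_Mapping.lookup (ind_exp ?Y))"
    proof (rule normally_torsion_free_packs[OF Y ntf[OF v]])
      fix D assume D: "D \<subseteq> ?Y" "\<And>A. A \<in> ?G \<Longrightarrow> A \<inter> D \<noteq> {}"
      \<comment> \<open>A cover of the contraction is a cover of \<open>F\<close> that avoids
        \<open>v\<close>.\<close>
      have "t \<le> card D"
      proof (rule cover)
        show "A \<inter> D \<noteq> {}" if "A \<in> F" for A using D(2)[of "A - {v}"] that by blast
      qed (use D(1) in blast)
      then show "t \<le> sum (Poly_Mapping.lookup (ind_exp ?Y)) D" using sum_lookup_ind_exp[OF Y(1) D(1)] by simp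
    qed (use Y(1) in simp)
    from packs_contraction[OF this]
    have "?Q (Poly_Mapping.single v t + (ind_exp X + f))"
    proof (rule packs_mono)
      fix w
      show "(if w = v then Poly_Mapping.lookup (ind_exp ?Y) v + t else Poly_Mapping.lookup (ind_exp ?Y) w)
        \<le> Poly_Mapping.lookup (Poly_Mapping.single v t + (ind_exp X + f)) w"
        using X(1) by (simp add: lookup_add lookup_single lookup_ind_exp)
    qed simp
    moreover have "\<not> ?Q (Poly_Mapping.single v t + (ind_exp X + f))"
      using spec[OF Q, of "Poly_Mapping.single v t"] v vC by simp
    ultimately show False by simp
  qed
  then have "C = X" using C by blast
  moreover have "Poly_Mapping.keys (ind_exp X + f) \<subseteq> X" using a f by (simp add: keys_add_nat)
  ultimately show ?thesis
    unfolding ideal_pow_edge_ideal[OF X] using Q by (intro var_ideal_in_Ass[of "ind_exp X + f"]) simp_all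
qed

text \<open>If \<open>t\<close> disjoint edges exist, a monomial witness must miss some variable
  \<open>v\<close>, so it witnesses the maximal ideal for the deletion of \<open>v\<close>. Normal
  torsion-freeness then makes every other variable an edge, and the singleton edges contradict the
  failure of the Koenig property.\<close>

lemma Ass_pow_lower_bound:
  fixes X :: "'v::linorder set"
  assumes X: "finite X" "F \<subseteq> Pow X" "{} \<notin> F"
    and ntf: "\<And>v. v \<in> X \<Longrightarrow> normally_torsion_free (mpoly_ring (X - {v}))
      (edge_ideal (X - {v}) {A \<in> F. v \<notin> A} :: ('v, 'k::field) mpoly set)"
    and not_koenig: "\<And>C. C \<subseteq> X \<Longrightarrow> (\<And>A. A \<in> F \<Longrightarrow> A \<inter> C \<noteq> {}) \<Longrightarrow> \<not> packs F (card C) (\<lambda>_. 1)"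
    and Ass: "var_ideal X X \<in> Ass (mpoly_ring X) (ideal_pow (mpoly_ring X) (edge_ideal X F :: ('v, 'k) mpoly set) t)"
  shows "\<not> packs F t (\<lambda>_. 1)"
proof
  assume packs: "packs F t (\<lambda>_. 1)"
  obtain e :: "'v \<Rightarrow>\<^sub>0 nat" where e: "Poly_Mapping.keys e \<subseteq> X" "\<not> packs F t (Poly_Mapping.lookup e)"
    and step: "\<forall>v\<in>X. packs F t (Poly_Mapping.lookup (e + Poly_Mapping.single v 1))"
    using Ass_witness[OF Ass[unfolded ideal_pow_edge_ideal[OF X(1,2)]]] by auto
  have "t \<ge> 1" using e(2) by (cases t) auto
  have "\<exists>v\<in>X. Poly_Mapping.lookup e v = 0"
  proof (rule ccontr)
    assume "\<not> ?thesis"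
    then have "Poly_Mapping.lookup (ind_exp X) v \<le> Poly_Mapping.lookup e v" for v
      using X(1) by (auto simp: lookup_ind_exp of_bool_def Suc_le_eq)
    then have "packs F t (Poly_Mapping.lookup e)"
      using packs_mono[OF packs_ind_exp[OF X(1,2) packs]] by blast
    then show False using e(2) by blast
  qed
  then obtain v where v: "v \<in> X" "Poly_Mapping.lookup e v = 0" by blast
  let ?Y = "X - {v}" and ?G = "{A \<in> F. v \<notin> A}"
  let ?J = "edge_ideal ?Y ?G :: ('v, 'k) mpoly set"
  have Y: "finite ?Y" "?G \<subseteq> Pow ?Y" using X by auto
  have eY: "Poly_Mapping.keys e \<subseteq> ?Y" using e(1) v(2) by (auto simp: in_keys_iff)
  \<comment> \<open>A packing within an exponent that vanishes at \<open>v\<close> uses only edges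
    of the deletion.\<close>
  have Q: "packs ?G t (Poly_Mapping.lookup (f + e)) \<longleftrightarrow> Poly_Mapping.keys f \<inter> ?Y \<noteq> {}"
    if f: "Poly_Mapping.keys f \<subseteq> ?Y" for f
  proof (cases "f = 0")
    case True
    have "\<not> packs ?G t (Poly_Mapping.lookup e)" using e(2) packs_subset[of ?G t _ F] by blast
    then show ?thesis using True by simp
  next
    case False
    then have "Poly_Mapping.keys f \<noteq> {}" by simp
    then obtain w where w: "w \<in> Poly_Mapping.keys f" by blast
    then have wX: "w \<in> X" "w \<noteq> v" using f by auto
    have "packs ?G t (Poly_Mapping.lookup (e + Poly_Mapping.single w 1))"
      using packs_deletion[OF bspec[OF step wX(1)], of v] v(2) wX(2)
      by (simp add: lookup_add lookup_single)
    then have "packs ?G t (Poly_Mapping.lookup (f + e))"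
    proof (rule packs_mono)
      fix u show "Poly_Mapping.lookup (e + Poly_Mapping.single w 1) u \<le> Poly_Mapping.lookup (f + e) u"
        using w by (auto simp: lookup_add lookup_single when_def in_keys_iff)
    qed simp
    then show ?thesis using w f by blast
  qed
  have "var_ideal ?Y ?Y \<in> Ass (mpoly_ring ?Y) (ideal_pow (mpoly_ring ?Y) ?J t)"
    unfolding ideal_pow_edge_ideal[OF Y] by (rule var_ideal_in_Ass[OF eY Q])
  then have "var_ideal ?Y ?Y \<in> Ass (mpoly_ring ?Y) ?J"
    using ntf[OF v(1)] \<open>t \<ge> 1\<close> unfolding normally_torsion_free_def by blast
  note edges = var_ideal_in_Ass_edge_ideal(2)[OF Y subset_refl this]
  have single: "{i} \<in> F" if i: "i \<in> ?Y" for i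
  proof -
    obtain A where A: "A \<in> ?G" "A \<inter> ?Y = {i}" using edges[OF i] by blast
    then have "A = {i}" using Y(2) by blast
    then show ?thesis using A(1) by simp
  qed
  \<comment> \<open>The singleton edges are disjoint, so they form a packing as large as
    \<open>C\<close>. An edge other than \<open>{v}\<close> has a vertex different from
    \<open>v\<close>, which lies in \<open>C\<close>; so \<open>C\<close> is a cover.\<close>
  define C where "C = {i \<in> X. {i} \<in> F}"
  have "A \<inter> C \<noteq> {}" if A: "A \<in> F" for A
  proof (cases "A = {v}")
    case True
    then show ?thesis using A v(1) by (simp add: C_def)
  next
    case False
    moreover have "A \<noteq> {}" using A X(3) by metis
    ultimately obtain i where "i \<in> A" "i \<noteq> v" by blast
    then show ?thesis using single[of i] A X(2) by (auto simp: C_def)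
  qed
  then have "\<not> packs F (card C) (\<lambda>_. 1)"
    by (intro not_koenig) (auto simp: C_def)
  moreover have "packs F (card ((\<lambda>i. {i}) ` C)) (\<lambda>_. 1)"
    by (rule packs_card_disjoint) (use X(1) in \<open>auto simp: C_def pairwise_def disjnt_def\<close>)
  ultimately show False by (simp add: card_image)
qed

theorem theorem4p6:
  fixes d :: nat
    and I :: "((nat \<Rightarrow>\<^sub>0 nat) \<Rightarrow>\<^sub>0 'k::field) set"
  assumes "squarefree_monomial_ideal {1..d} I"
    and "I \<noteq> carrier (mpoly_ring {1..d})"
    and "\<forall>Y J. proper_minor ({1..d}, I) (Y, J) \<longrightarrow> normally_torsion_free (mpoly_ring Y) J"
    and "\<not> packing_property {1..d} I"
  shows "genideal (mpoly_ring {1..d}) (var ` {1..d})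
           \<in> Ass (mpoly_ring {1..d}) (ideal_pow (mpoly_ring {1..d}) I (beta1 I + 1)) \<and>
         (\<forall>t. genideal (mpoly_ring {1..d}) (var ` {1..d})
                \<in> Ass (mpoly_ring {1..d}) (ideal_pow (mpoly_ring {1..d}) I t)
              \<longrightarrow> beta1 I + 1 \<le> t)"
proof -
  let ?X = "{1..d}"
  have fin: "finite ?X" by simp
  obtain F where F: "F \<subseteq> Pow ?X" "I = edge_ideal ?X F"
    using squarefree_monomial_ideal_imp_edge_ideal[OF fin assms(1)] by blast
  have ne: "{} \<notin> F"
  proof
    assume "{} \<in> F"
    then have "I = carrier (mpoly_ring ?X)"
      unfolding F(2) by (auto simp: edge_ideal_def mono_ideal_def carrier_mpoly_ring)
    then show False using assms(2) by blast
  qed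
  \<comment> \<open>Proper minors are Koenig, so the failure of packing has to occur at
    \<open>I\<close> itself.\<close>
  have "koenig Y J" if "proper_minor (?X, I) (Y, J)" for Y and J :: "(nat, 'k) mpoly set"
  proof -
    have "minor (?X, edge_ideal ?X F) (Y, J)"
      using that unfolding proper_minor_def minor_def F(2) by (rule tranclp_into_rtranclp)
    from minor_edge_ideal[OF this fin F(1)] obtain G where "finite Y" "G \<subseteq> Pow Y" "J = edge_ideal Y G" by blast
    then show ?thesis
      using normally_torsion_free_koenig assms(3) that by blast
  qed
  then have "\<not> koenig ?X I"
    using assms(4) unfolding packing_property_def minor_def proper_minor_def
    by (metis Pair_inject rtranclpD)
  then have not_koenig: "\<not> packs F (card C) (\<lambda>_. 1)"
    if "C \<subseteq> ?X" "\<And>A. A \<in> F \<Longrightarrow> A \<inter> C \<noteq> {}" for C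
    using koenig_edge_ideal[OF fin F(1) that] unfolding F(2) by blast
  have packs_iff: "packs F t (\<lambda>_. 1) \<longleftrightarrow> t \<le> beta1 I" for t
    unfolding F(2) by (rule le_beta1_edge_ideal[OF fin F(1) ne])
  have step: "normally_torsion_free (mpoly_ring (?X - {v})) (deletion ?X v I)"
    "normally_torsion_free (mpoly_ring (?X - {v})) (contraction ?X v I)" if "v \<in> ?X" for v
  proof -
    have "minor_step (?X, I) (?X - {v}, deletion ?X v I)"
      "minor_step (?X, I) (?X - {v}, contraction ?X v I)"
      using that unfolding minor_step_def by blast+
    then have "proper_minor (?X, I) (?X - {v}, deletion ?X v I)"
      "proper_minor (?X, I) (?X - {v}, contraction ?X v I)"
      unfolding proper_minor_def by (auto intro: tranclp.r_into_trancl)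
    then show "normally_torsion_free (mpoly_ring (?X - {v})) (deletion ?X v I)"
      "normally_torsion_free (mpoly_ring (?X - {v})) (contraction ?X v I)"
      using assms(3) by blast+
  qed
  have m: "genideal (mpoly_ring ?X) (var ` ?X) = (var_ideal ?X ?X :: (nat, 'k) mpoly set)"
    by (rule genideal_var[OF fin])
  show ?thesis
    unfolding m
  proof (intro conjI allI impI)
    show "var_ideal ?X ?X \<in> Ass (mpoly_ring ?X) (ideal_pow (mpoly_ring ?X) I (beta1 I + 1))"
      unfolding F(2)
    proof (rule max_ideal_in_Ass[OF fin F(1)])
      fix v assume "v \<in> ?X"
      from step(2)[OF this] show "normally_torsion_free (mpoly_ring (?X - {v}))
          (edge_ideal (?X - {v}) ((\<lambda>A. A - {v}) ` F) :: (nat, 'k) mpoly set)"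
        unfolding F(2) contraction_edge_ideal[OF fin F(1)] .
    next
      fix C assume "C \<subseteq> ?X" "\<And>A. A \<in> F \<Longrightarrow> A \<inter> C \<noteq> {}"
      \<comment> \<open>There are no \<open>card C\<close> disjoint edges, so \<open>card C\<close>
        exceeds the maximal number of disjoint edges; this gives the \<open>+ 1\<close>.\<close>
      from not_koenig[OF this] show "beta1 (edge_ideal ?X F :: (nat, 'k) mpoly set) + 1 \<le> card C"
        unfolding packs_iff F(2) by simp
    qed (use packs_iff F(2) in simp)
  next
    fix t assume Ass: "var_ideal ?X ?X \<in> Ass (mpoly_ring ?X) (ideal_pow (mpoly_ring ?X) I t)"
    have "\<not> packs F t (\<lambda>_. 1)"
    proof (rule Ass_pow_lower_bound[OF fin F(1) ne _ not_koenig Ass[unfolded F(2)]])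
      fix v assume "v \<in> ?X"
      from step(1)[OF this] show "normally_torsion_free (mpoly_ring (?X - {v}))
          (edge_ideal (?X - {v}) {A \<in> F. v \<notin> A} :: (nat, 'k) mpoly set)"
        unfolding F(2) deletion_edge_ideal[OF fin F(1)] .
    qed
    then show "beta1 I + 1 \<le> t" unfolding packs_iff by simp
  qed
qed

end
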